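(* Let $V:\mathbb{Z}^N\to\mathbb{R}$ be a potential on the lattice graph $\mathbb{Z}^N$ satisfying $$-1<\inf_{x\in\mathbb{Z}^N}V(x)\le\sup_{x\in\mathbb{Z}^N}V(x)=V_\infty<\infty\quad\text{with}\quad V_\infty=\lim_{|x|\to\infty}V(x).$$ Then the problem $$-\Delta u+V(x)u=u\log u^2,\quad x\in\mathbb{Z}^N,$$ has a ground state solution $u$. Moreover, $u(x)>0$ for all $x\in\mathbb{Z}^N$ or $u(x)<0$ for all $x\in\mathbb{Z}^N$.
   Context: The lattice graph $\mathbb{Z}^N$ has vertex set $\mathbb{Z}^N$ and edges $\{x,y\}$ with $\sum_{i=1}^N|x_i-y_i|=1$ (written $x\sim y$). All functions are real valued, $\mu$ is the counting measure, $\int_{\mathbb{Z}^N}f\,d\mu=\sum_{x}f(x)$, $\Delta u(x)=\sum_{y\sim x}(u(y)-u(x))$, $|\nabla u|^2(x)=\frac12\sum_{y\sim x}(u(y)-u(x))^2$. $H^1(\mathbb{Z}^N)$ is the completion of the finitely supported functions under $\left(\int(|\nabla u|^2+u^2)d\mu\right)^{1/2}$, and $X=\{u\in H^1(\mathbb{Z}^N):\int(V+1)u^2\,d\mu<\infty\}$. The energy $J:X\to(-\infty,+\infty]$ is $$J(u)=\frac12\int_{\mathbb{Z}^N}\left(|\nabla u|^2+(V(x)+1)u^2\right)d\mu-\frac12\int_{\mathbb{Z}^N}u^2\log u^2\,d\mu$$ with $0\log 0=0$; $D(J)=\{u\in X:J(u)<+\infty\}$. The Nehari manifold is $$\mathcal{N}=\left\{u\in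 D(J)\setminus\{0\}:\int_{\mathbb{Z}^N}(|\nabla u|^2+V u^2)\,d\mu=\int_{\mathbb{Z}^N}u^2\log u^2\,d\mu\right\}.$$ A solution is $u\in D(J)$ satisfying the equation at every vertex; a ground state solution is a nontrivial solution $u$ with $J(u)=\inf_{\mathcal{N}}J$. *)

theory Defs
  imports "HOL-Analysis.Analysis"
begin

definition adj :: "int ^ 'n \<Rightarrow> int ^ 'n \<Rightarrow> bool" (infix "\<sim>" 50)
  where "x \<sim> y \<longleftrightarrow> (\<Sum>i\<in>UNIV. \<bar>x $ i - y $ i\<bar>) = 1"

text \<open>Hence no sum over neighbours below is an infinite one with the default value 0.\<close>

lemma finite_neighbours: "finite {y. x \<sim> y}"
proof -
  have "y $ i \<in> {x $ i - 1 .. x $ i + 1}" if "x \<sim> y" for y i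
  proof -
    have "\<bar>x $ i - y $ i\<bar> \<le> 1"
      using that member_le_sum[of i UNIV "\<lambda>i. \<bar>x $ i - y $ i\<bar>"]
      by (simp add: adj_def)
    then show ?thesis
      by auto
  qed
  then have "vec_nth ` {y. x \<sim> y} \<subseteq> (\<Pi>\<^sub>E i\<in>UNIV. {x $ i - 1 .. x $ i + 1})"
    by (auto simp: PiE_UNIV_domain)
  then have "finite (vec_nth ` {y. x \<sim> y})"
    by (rule finite_subset) (auto intro: finite_PiE)
  moreover have "inj_on vec_nth {y. x \<sim> y}"
    by (simp add: inj_on_def vec_nth_inject)
  ultimately show ?thesis
    by (rule finite_imageD)
qed

definition laplacian :: "(int ^ 'n \<Rightarrow> real) \<Rightarrow> int ^ 'n \<Rightarrow> real"
  where "laplacian u x = (\<Sum>y | x \<sim> y. u y - u x)"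

definition grad_sq :: "(int ^ 'n \<Rightarrow> real) \<Rightarrow> int ^ 'n \<Rightarrow> real"
  where "grad_sq u x = 1 / 2 * (\<Sum>y | x \<sim> y. (u y - u x)\<^sup>2)"

text \<open>
  The integral with respect to the counting measure, with values in the extended reals,
  as the energy may be infinite. It is meaningful when the positive or the negative part of
  the integrand has finite integral (in \<^typ>\<open>ereal\<close>, the difference of two positive infinities
  is by convention positive infinity). This holds for every integral below when the potential
  is bounded and greater than -1: a function in \<open>H1\<close> is square summable, so it exceeds 1 in
  absolute value at finitely many vertices only, and the positive part of
  \<open>u\<^sup>2 log u\<^sup>2\<close> has finite integral.
\<close>

definition integral_count :: "('a \<Rightarrow> real) \<Rightarrow> ereal"
  where "integral_count f =
    enn2ereal (\<integral>\<^sup>+x. ennreal (f x) \<partial>count_space UNIV)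
    - enn2ereal (\<integral>\<^sup>+x. ennreal (- f x) \<partial>count_space UNIV)"

definition H1_norm_sq :: "(int ^ 'n \<Rightarrow> real) \<Rightarrow> ereal"
  where "H1_norm_sq u = integral_count (\<lambda>x. grad_sq u x + (u x)\<^sup>2)"

text \<open>
  The completion of the finitely supported functions, realised as a space of functions:
  the norm dominates all point evaluations, so Cauchy sequences converge pointwise and
  the elements of the completion are the functions that are norm limits of finitely
  supported ones.
\<close>

definition H1 :: "(int ^ 'n \<Rightarrow> real) set"
  where "H1 = {u. \<exists>\<phi> :: nat \<Rightarrow> int ^ 'n \<Rightarrow> real.
    (\<forall>k. finite {x. \<phi> k x \<noteq> 0}) \<and>
    (\<lambda>k. H1_norm_sq (\<lambda>x. u x - \<phi> k x)) \<longlonglongrightarrow> 0}"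

definition energy_space :: "(int ^ 'n \<Rightarrow> real) \<Rightarrow> (int ^ 'n \<Rightarrow> real) set"
  where "energy_space V = {u \<in> H1. integral_count (\<lambda>x. (V x + 1) * (u x)\<^sup>2) < \<infinity>}"

text \<open>The convention \<open>0 log 0 = 0\<close> holds since the factor in front of \<^const>\<open>ln\<close> vanishes.\<close>

definition energy :: "(int ^ 'n \<Rightarrow> real) \<Rightarrow> (int ^ 'n \<Rightarrow> real) \<Rightarrow> ereal"
  where "energy V u =
    ereal (1 / 2) * integral_count (\<lambda>x. grad_sq u x + (V x + 1) * (u x)\<^sup>2)
    - ereal (1 / 2) * integral_count (\<lambda>x. (u x)\<^sup>2 * ln ((u x)\<^sup>2))"

definition energy_domain :: "(int ^ 'n \<Rightarrow> real) \<Rightarrow> (int ^ 'n \<Rightarrow> real) set"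
  where "energy_domain V = {u \<in> energy_space V. energy V u < \<infinity>}"

definition nehari :: "(int ^ 'n \<Rightarrow> real) \<Rightarrow> (int ^ 'n \<Rightarrow> real) set"
  where "nehari V = {u \<in> energy_domain V - {\<lambda>_. 0}.
    integral_count (\<lambda>x. grad_sq u x + V x * (u x)\<^sup>2)
    = integral_count (\<lambda>x. (u x)\<^sup>2 * ln ((u x)\<^sup>2))}"

definition is_solution :: "(int ^ 'n \<Rightarrow> real) \<Rightarrow> (int ^ 'n \<Rightarrow> real) \<Rightarrow> bool"
  where "is_solution V u \<longleftrightarrow> u \<in> energy_domain V \<and>
    (\<forall>x. - laplacian u x + V x * u x = u x * ln ((u x)\<^sup>2))"

definition is_ground_state :: "(int ^ 'n \<Rightarrow> real) \<Rightarrow> (int ^ 'n \<Rightarrow> real) \<Rightarrow> bool"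
  where "is_ground_state V u \<longleftrightarrow> is_solution V u \<and> u \<noteq> (\<lambda>_. 0) \<and>
    energy V u = (INF v\<in>nehari V. energy V v)"

definition lattice_norm :: "int ^ 'n \<Rightarrow> real"
  where "lattice_norm x = norm (\<chi> i. real_of_int (x $ i))"

text \<open>The filter \<open>\<bar>x\<bar> \<rightarrow> \<infinity>\<close>; \<^const>\<open>at_infinity\<close> is not available on \<open>int ^ 'n\<close>.\<close>

definition lattice_at_infinity :: "(int ^ 'n) filter"
  where "lattice_at_infinity = filtercomap lattice_norm at_top"

end

theory Submission
  imports Defs "HOL-Complex_Analysis.Great_Picard" "HOL-Real_Asymp.Real_Asymp"
begin

text \<open>
  Write \<open>E(u)\<close> for the sum of \<open>|\<nabla>u|\<^sup>2 + V u\<^sup>2 - u\<^sup>2 ln u\<^sup>2\<close>, called the action below, and \<open>M(u)\<close> for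
  the sum of \<open>u\<^sup>2\<close>, called the mass. The Nehari manifold is given by \<open>E = 0\<close>, and there the energy is
  \<open>M / 2\<close>. Since \<open>E(c u) = c\<^sup>2 (E(u) - M(u) ln c\<^sup>2)\<close>, minimising the energy on the Nehari manifold is
  the same as minimising \<open>E\<close> on the unit sphere of \<open>l\<^sup>2\<close>. If \<open>m\<close> is the infimum there, homogeneity
  gives the logarithmic Sobolev inequality \<open>m M(w) - M(w) ln M(w) \<le> E(w)\<close>, and a unit minimiser
  \<open>u\<close> yields the point \<open>exp (m / 2) u\<close> of the Nehari manifold with the least energy, namely half of \<open>exp m\<close>.

  The compactness of a minimising sequence comes from the entropy \<open>- u\<^sup>2 ln u\<^sup>2\<close> and is due to two
  effects. A unit vector whose entries are all small has large entropy (\<open>action_ge_entropy\<close>), so the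
  sequence does not vanish after suitable translations, and a subsequence has a nonzero pointwise limit.
  Moreover, cutting a unit vector along a finite set into pieces of mass \<open>a\<close> and \<open>1 - a\<close> changes
  \<open>E\<close> only by products across the cut edges (\<open>action_cut\<close>), while the inequality applied to both
  pieces gains \<open>- a ln a - (1 - a) ln (1 - a)\<close>. Hence no mass is lost in the limit
  (\<open>limit_mass_eq_1\<close>), and Fatou's lemma shows that the limit minimises the action for the limiting
  potential. The latter is a translate of \<open>V\<close> or the constant \<open>V_inf\<close>, according to whether the
  centres of the translations stay bounded. As \<open>V\<close> lies below \<open>V_inf\<close>, the limit is also, up to a
  translation, a minimiser for \<open>V\<close> itself (\<open>minimiser_exists\<close>).

  Absolute values do not increase the action, so the minimiser may be taken nonnegative. Varying its
  value at one vertex gives the equation with the Lagrange multiplier \<open>m\<close> (\<open>minimiser_equation\<close>),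
  which the scaling by \<open>exp (m / 2)\<close> absorbs. At a zero of \<open>u\<close> the equation says that \<open>u\<close> vanishes at
  all neighbours, so by connectedness \<open>u\<close> is positive everywhere (\<open>nonneg_solution_pos\<close>).
\<close>

section \<open>Unconditional sums\<close>

lemma summable_on_dominated:
  fixes f g :: "'a \<Rightarrow> real"
  assumes "g summable_on A" and "\<And>x. x \<in> A \<Longrightarrow> \<bar>f x\<bar> \<le> g x"
  shows "f summable_on A"
proof -
  have "(\<lambda>x. \<bar>f x\<bar>) summable_on A"
    by (rule summable_on_comparison_test[OF assms(1)]) (use assms(2) in auto)
  then show ?thesis
    using summable_on_iff_abs_summable_on_real[of f A] by simp
qed

lemma infsum_diff_real:
  fixes f g :: "'a \<Rightarrow> real"
  assumes "f summable_on A" and "g summable_on A"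
  shows "(\<lambda>x. f x - g x) summable_on A"
    and "infsum (\<lambda>x. f x - g x) A = infsum f A - infsum g A"
  using has_sum_add[OF has_sum_infsum[OF assms(1)]
      has_sum_uminusI[OF has_sum_infsum[OF assms(2)]]]
  by (auto simp: has_sum_iff)

lemma has_sum_finite_Sum:
  fixes f :: "'b \<Rightarrow> 'a \<Rightarrow> real"
  assumes "finite I" and "\<And>i. i \<in> I \<Longrightarrow> (f i has_sum s i) A"
  shows "((\<lambda>x. \<Sum>i\<in>I. f i x) has_sum (\<Sum>i\<in>I. s i)) A"
  using assms by (induction I) (auto intro!: has_sum_add)

lemma has_sum_translate:
  fixes f :: "'a::group_add \<Rightarrow> real"
  shows "((\<lambda>x. f (x + a)) has_sum s) UNIV \<longleftrightarrow> (f has_sum s) UNIV"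
proof -
  have "bij (\<lambda>x. x + a)"
    by (rule bij_betw_byWitness[where f' = "\<lambda>x. x - a"]) auto
  then show ?thesis
    by (rule has_sum_reindex_bij_betw)
qed

lemma summable_on_translate:
  fixes f :: "'a::group_add \<Rightarrow> real"
  shows "(\<lambda>x. f (x + a)) summable_on UNIV \<longleftrightarrow> f summable_on UNIV"
  by (simp add: summable_on_def has_sum_translate)

lemma infsum_translate:
  fixes f :: "'a::group_add \<Rightarrow> real"
  shows "(\<Sum>\<^sub>\<infinity>x. f (x + a)) = (\<Sum>\<^sub>\<infinity>x. f x)"
proof (cases "f summable_on UNIV")
  case True
  then show ?thesis
    using has_sum_translate[of f a] by (intro infsumI) simp
next
  case False
  then show ?thesis
    using summable_on_translate[of f a] by (simp add: infsum_not_exists)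
qed

text \<open>Finite partial sums pass to the limit, and a nonnegative sum is the supremum of its finite
  partial sums.\<close>

lemma infsum_Fatou:
  fixes f :: "'a \<Rightarrow> real" and g :: "nat \<Rightarrow> 'a \<Rightarrow> real"
  assumes lim: "\<And>x. (\<lambda>n. g n x) \<longlonglongrightarrow> f x"
    and nonneg: "\<And>n x. 0 \<le> g n x"
    and summable: "\<And>n. g n summable_on UNIV"
    and bound: "(\<lambda>n. infsum (g n) UNIV) \<longlonglongrightarrow> c"
  shows "f summable_on UNIV \<and> infsum f UNIV \<le> c"
proof -
  have partial: "sum f F \<le> c" if "finite F" for F
  proof (rule LIMSEQ_le[OF _ bound])
    show "(\<lambda>n. sum (g n) F) \<longlonglongrightarrow> sum f F"
      by (intro tendsto_sum lim)
    show "\<exists>N. \<forall>n\<ge>N. sum (g n) F \<le> infsum (g n) UNIV"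
      using that nonneg summable by (auto intro!: finite_sum_le_infsum)
  qed
  have "0 \<le> f x" for x
    by (rule LIMSEQ_le_const[OF lim]) (use nonneg in auto)
  then have "f summable_on UNIV"
    using partial by (intro nonneg_bdd_above_summable_on) (auto intro!: bdd_aboveI)
  then show ?thesis
    using partial by (auto intro: infsum_le_finite_sums)
qed

section \<open>Integrals over the counting measure\<close>

lemma nn_integral_count_space_infsum:
  fixes f :: "'a \<Rightarrow> real"
  assumes "f summable_on UNIV" and "\<And>x. 0 \<le> f x"
  shows "(\<integral>\<^sup>+x. ennreal (f x) \<partial>count_space UNIV) = ennreal (infsum f UNIV)"
proof -
  have "Infinite_Sum.abs_summable_on f UNIV"
    using assms by simp
  then have "Infinite_Set_Sum.abs_summable_on f UNIV"
    by (simp only: abs_summable_equivalent)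
  with assms(2) show ?thesis
    by (simp only: nn_integral_conv_infsetsum infsetsum_infsum)
qed

lemma nn_integral_count_space_not_summable:
  fixes f :: "'a \<Rightarrow> real"
  assumes "\<not> f summable_on UNIV" and nonneg: "\<And>x. 0 \<le> f x"
  shows "(\<integral>\<^sup>+x. ennreal (f x) \<partial>count_space UNIV) = \<infinity>"
proof (rule ccontr)
  assume "(\<integral>\<^sup>+x. ennreal (f x) \<partial>count_space UNIV) \<noteq> \<infinity>"
  then have "integrable (count_space UNIV) f"
    using nonneg by (intro integrableI_nonneg) (auto simp: top.not_eq_extremum)
  then have "Infinite_Set_Sum.abs_summable_on f UNIV"
    by (simp add: Infinite_Set_Sum.abs_summable_on_def)
  then have "(\<lambda>x. norm (f x)) summable_on UNIV"
    by (simp only: abs_summable_equivalent)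
  with assms show False
    by simp
qed

lemma integral_count_pos_neg_parts:
  "integral_count f =
    enn2ereal (\<integral>\<^sup>+x. ennreal (max 0 (f x)) \<partial>count_space UNIV)
    - enn2ereal (\<integral>\<^sup>+x. ennreal (max 0 (- f x)) \<partial>count_space UNIV)"
proof -
  have "ennreal (max 0 a) = ennreal a" for a
    by (simp add: max_def ennreal_neg)
  then show ?thesis
    by (simp add: integral_count_def)
qed

lemma integral_count_summable:
  fixes f :: "'a \<Rightarrow> real"
  assumes f: "f summable_on UNIV"
  shows "integral_count f = ereal (infsum f UNIV)"
proof -
  have abs: "(\<lambda>x. \<bar>f x\<bar>) summable_on UNIV"
    using f summable_on_iff_abs_summable_on_real[of f UNIV] by simp
  have pos: "(\<lambda>x. max 0 (f x)) summable_on UNIV" and neg: "(\<lambda>x. max 0 (- f x)) summable_on UNIV"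
    by (rule summable_on_dominated[OF abs], simp)+
  have "infsum f UNIV = infsum (\<lambda>x. max 0 (f x)) UNIV - infsum (\<lambda>x. max 0 (- f x)) UNIV"
    by (subst infsum_diff_real(2)[OF pos neg, symmetric]) (auto intro!: infsum_cong)
  then show ?thesis
    unfolding integral_count_pos_neg_parts
    using nn_integral_count_space_infsum[OF pos] nn_integral_count_space_infsum[OF neg]
    by (simp add: enn2ereal_ennreal infsum_nonneg)
qed

lemma integral_count_nonneg_not_summable:
  fixes f :: "'a \<Rightarrow> real"
  assumes "\<not> f summable_on UNIV" and "\<And>x. 0 \<le> f x"
  shows "integral_count f = \<infinity>"
proof -
  have "ennreal (- f x) = 0" for x
    using assms(2)[of x] by (simp add: ennreal_neg)
  then show ?thesis
    by (simp add: integral_count_def nn_integral_count_space_not_summable[OF assms])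
qed

lemma integral_count_eq_minus_infinity:
  fixes f :: "'a \<Rightarrow> real"
  assumes not: "\<not> f summable_on UNIV" and pos: "(\<lambda>x. max 0 (f x)) summable_on UNIV"
  shows "integral_count f = - \<infinity>"
proof -
  have "\<not> (\<lambda>x. max 0 (- f x)) summable_on UNIV"
  proof
    assume "(\<lambda>x. max 0 (- f x)) summable_on UNIV"
    from infsum_diff_real(1)[OF pos this] have "f summable_on UNIV"
      by (rule summable_on_cong[THEN iffD1, rotated]) auto
    with not show False ..
  qed
  then have "(\<integral>\<^sup>+x. ennreal (max 0 (- f x)) \<partial>count_space UNIV) = \<infinity>"
    by (rule nn_integral_count_space_not_summable) simp
  then show ?thesis
    unfolding integral_count_pos_neg_parts
    using nn_integral_count_space_infsum[OF pos]
    by (simp add: enn2ereal_ennreal infsum_nonneg)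
qed

section \<open>Sums over edges of the lattice\<close>

lemma adj_translate: "x + a \<sim> y + a \<longleftrightarrow> x \<sim> y"
  by (simp add: adj_def)

definition unit_vectors :: "(int ^ 'n) set"
  where "unit_vectors = {e. 0 \<sim> e}"

lemma finite_unit_vectors: "finite unit_vectors"
  unfolding unit_vectors_def by (rule finite_neighbours)

lemma sum_neighbours:
  "(\<Sum>y | x \<sim> y. f y) = (\<Sum>e\<in>unit_vectors. f (x + e))"
proof (rule sum.reindex_bij_witness[where i = "\<lambda>e. x + e" and j = "\<lambda>y. y - x"])
  show "y - x \<in> unit_vectors" if "y \<in> {y. x \<sim> y}" for y
    using that adj_translate[of 0 x "y - x"] by (simp add: unit_vectors_def)
  show "x + e \<in> {y. x \<sim> y}" if "e \<in> unit_vectors" for e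
    using that adj_translate[of 0 x e] by (simp add: unit_vectors_def add.commute)
qed auto

lemma minus_unit_vector: "- e \<in> unit_vectors \<longleftrightarrow> e \<in> unit_vectors"
  by (simp add: unit_vectors_def adj_def)

lemma sum_unit_vectors_minus:
  "(\<Sum>e\<in>unit_vectors. s (- e)) = (\<Sum>e\<in>unit_vectors. s e)"
  by (rule sum.reindex_bij_witness[where i = uminus and j = uminus])
    (auto simp: minus_unit_vector)

text \<open>Every edge occurs in both directions. For a fixed displacement, the sum over the reversed
  edges is a translate of the original one.\<close>

lemma edge_sum_swap:
  fixes F :: "int ^ 'n \<Rightarrow> int ^ 'n \<Rightarrow> real"
  assumes "\<And>e. e \<in> unit_vectors \<Longrightarrow> (\<lambda>x. F x (x + e)) summable_on UNIV"
  shows "(\<lambda>x. \<Sum>y | x \<sim> y. F x y) summable_on UNIV"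
    and "(\<lambda>x. \<Sum>y | x \<sim> y. F y x) summable_on UNIV"
    and "(\<Sum>\<^sub>\<infinity>x. \<Sum>y | x \<sim> y. F y x) = (\<Sum>\<^sub>\<infinity>x. \<Sum>y | x \<sim> y. F x y)"
proof -
  define s where "s e = (\<Sum>\<^sub>\<infinity>x. F x (x + e))" for e
  have forward: "((\<lambda>x. F x (x + e)) has_sum s e) UNIV" if "e \<in> unit_vectors" for e
    using assms[OF that] by (simp add: s_def)
  have backward: "((\<lambda>x. F (x + e) x) has_sum s (- e)) UNIV" if "e \<in> unit_vectors" for e
  proof -
    have "- e \<in> unit_vectors"
      using that by (simp add: minus_unit_vector)
    from forward[OF this] show ?thesis
      by (subst (asm) has_sum_translate[where a = e, symmetric]) simp
  qed
  have "((\<lambda>x. \<Sum>y | x \<sim> y. F x y) has_sum (\<Sum>e\<in>unit_vectors. s e)) UNIV"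
    unfolding sum_neighbours by (rule has_sum_finite_Sum[OF finite_unit_vectors forward])
  moreover have "((\<lambda>x. \<Sum>y | x \<sim> y. F y x) has_sum (\<Sum>e\<in>unit_vectors. s (- e))) UNIV"
    unfolding sum_neighbours by (rule has_sum_finite_Sum[OF finite_unit_vectors backward])
  moreover have "(\<Sum>e\<in>unit_vectors. s (- e)) = (\<Sum>e\<in>unit_vectors. s e)"
    by (rule sum_unit_vectors_minus)
  ultimately show "(\<lambda>x. \<Sum>y | x \<sim> y. F x y) summable_on UNIV"
    and "(\<lambda>x. \<Sum>y | x \<sim> y. F y x) summable_on UNIV"
    and "(\<Sum>\<^sub>\<infinity>x. \<Sum>y | x \<sim> y. F y x) = (\<Sum>\<^sub>\<infinity>x. \<Sum>y | x \<sim> y. F x y)"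
    by (simp_all add: has_sum_iff)
qed

text \<open>From any other vertex, a step that moves one differing coordinate by 1 comes closer to \<open>z\<close> in
  the \<open>l\<^sup>1\<close> distance, so the lattice graph is connected.\<close>

lemma neighbour_closed_eq_UNIV:
  fixes S :: "(int ^ 'n) set"
  assumes "z \<in> S" and closed: "\<And>x y. x \<in> S \<Longrightarrow> x \<sim> y \<Longrightarrow> y \<in> S"
  shows "S = UNIV"
proof -
  have "x \<in> S" if "(\<Sum>i\<in>UNIV. \<bar>x $ i - z $ i\<bar>) = int k" for x k
    using that
  proof (induction k arbitrary: x)
    case 0
    then have "x = z"
      by (simp add: sum_nonneg_eq_0_iff vec_eq_iff)
    then show ?case
      using assms(1) by simp
  next
    case (Suc k)
    then obtain i where i: "x $ i \<noteq> z $ i"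
      by (force intro: ccontr)
    define y where "y = (\<chi> j. if j = i then x $ i + sgn (z $ i - x $ i) else x $ j)"
    have "(\<Sum>j\<in>UNIV. \<bar>y $ j - z $ j\<bar>) = (\<Sum>j\<in>UNIV. \<bar>x $ j - z $ j\<bar> - (if j = i then 1 else 0))"
      using i by (intro sum.cong) (auto simp: y_def sgn_if)
    then have "(\<Sum>j\<in>UNIV. \<bar>y $ j - z $ j\<bar>) = int k"
      using Suc.prems by (simp add: sum_subtractf)
    moreover have "y \<sim> x"
    proof -
      have "(\<Sum>j\<in>UNIV. \<bar>y $ j - x $ j\<bar>) = (\<Sum>j\<in>UNIV. if j = i then 1 else 0)"
        using i by (intro sum.cong) (auto simp: y_def sgn_if)
      then show ?thesis
        by (simp add: adj_def)
    qed
    ultimately show ?case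
      using Suc.IH closed by blast
  qed
  then have "x \<in> S" for x
    by (metis abs_ge_zero sum_nonneg zero_le_imp_eq_int)
  then show ?thesis
    by auto
qed

section \<open>Square-summable functions and the Dirichlet form\<close>

definition square_summable :: "('a \<Rightarrow> real) \<Rightarrow> bool"
  where "square_summable u \<longleftrightarrow> (\<lambda>x. (u x)\<^sup>2) summable_on UNIV"

definition mass :: "('a \<Rightarrow> real) \<Rightarrow> real"
  where "mass u = (\<Sum>\<^sub>\<infinity>x. (u x)\<^sup>2)"

lemma summable_product:
  assumes "square_summable u" and "square_summable v"
  shows "(\<lambda>x. u x * v x) summable_on UNIV"
proof (rule summable_on_dominated)
  show "(\<lambda>x. (u x)\<^sup>2 + (v x)\<^sup>2) summable_on UNIV"
    using assms unfolding square_summable_def by (rule summable_on_add)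
  show "\<bar>u x * v x\<bar> \<le> (u x)\<^sup>2 + (v x)\<^sup>2" for x
  proof -
    have "0 \<le> \<bar>u x\<bar> * \<bar>v x\<bar>"
      by simp
    then show ?thesis
      using sum_squares_bound[of "\<bar>u x\<bar>" "\<bar>v x\<bar>"] unfolding abs_mult power2_abs by linarith
  qed
qed

lemma square_summable_add:
  assumes "square_summable u" and "square_summable v"
  shows "square_summable (\<lambda>x. u x + v x)"
proof -
  have "(\<lambda>x. (u x)\<^sup>2 + (v x)\<^sup>2 + 2 * (u x * v x)) summable_on UNIV"
    using assms summable_product[OF assms]
    unfolding square_summable_def by (intro summable_on_add summable_on_cmult_right)
  then show ?thesis
    by (simp add: square_summable_def power2_eq_square algebra_simps)
qed

lemma square_summable_scale:
  assumes "square_summable u"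
  shows "square_summable (\<lambda>x. c * u x)"
  using summable_on_cmult_right[OF assms[unfolded square_summable_def], of "c\<^sup>2"]
  by (simp add: square_summable_def power_mult_distrib)

lemma mass_scale: "mass (\<lambda>x. c * u x) = c\<^sup>2 * mass u"
  by (simp add: mass_def power_mult_distrib infsum_cmult_right')

lemma square_summable_dominated:
  assumes "square_summable v" and "\<And>x. \<bar>u x\<bar> \<le> \<bar>v x\<bar>"
  shows "square_summable u"
  unfolding square_summable_def
  by (rule summable_on_dominated[OF assms(1)[unfolded square_summable_def]])
    (use assms(2) abs_le_square_iff in auto)

lemma square_summable_finite_support:
  assumes "finite {x. u x \<noteq> 0}"
  shows "square_summable u"
  unfolding square_summable_def
  by (rule finite_nonzero_values_imp_summable_on) (use assms in simp)

lemma square_summable_translate: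
  fixes u :: "'a::group_add \<Rightarrow> real"
  shows "square_summable (\<lambda>x. u (x + a)) \<longleftrightarrow> square_summable u"
  using summable_on_translate[of "\<lambda>x. (u x)\<^sup>2" a] by (simp add: square_summable_def)

lemma mass_translate:
  fixes u :: "'a::group_add \<Rightarrow> real"
  shows "mass (\<lambda>x. u (x + a)) = mass u"
  using infsum_translate[of "\<lambda>x. (u x)\<^sup>2" a] by (simp add: mass_def)

lemma mass_nonneg: "0 \<le> mass u"
  unfolding mass_def by (rule infsum_nonneg) simp

lemma sum_squares_le_mass:
  assumes "square_summable u" and "finite F"
  shows "(\<Sum>x\<in>F. (u x)\<^sup>2) \<le> mass u"
  using assms unfolding mass_def square_summable_def by (intro finite_sum_le_infsum) auto

lemma square_le_mass: "square_summable u \<Longrightarrow> (u x)\<^sup>2 \<le> mass u"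
  using sum_squares_le_mass[of u "{x}"] by simp

lemma mass_eq_0_iff:
  assumes "square_summable u"
  shows "mass u = 0 \<longleftrightarrow> u = (\<lambda>_. 0)"
proof
  assume "mass u = 0"
  then have "(u x)\<^sup>2 \<le> 0" for x
    using square_le_mass[OF assms, of x] by simp
  then show "u = (\<lambda>_. 0)"
    by auto
qed (simp add: mass_def)

lemma mass_pos:
  assumes "square_summable u" and "u \<noteq> (\<lambda>_. 0)"
  shows "0 < mass u"
  using mass_nonneg[of u] mass_eq_0_iff[OF assms(1)] assms(2) by simp

text \<open>Up to sign, the product of the differences is the sum of \<open>v x (u y - u x)\<close> over the two
  orientations of the edge, and both orientations have the same total.\<close>

lemma green:
  fixes u v :: "int ^ 'n \<Rightarrow> real"
  assumes u: "square_summable u" and v: "square_summable v"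
  shows "(\<lambda>x. \<Sum>y | x \<sim> y. (u y - u x) * (v y - v x)) summable_on UNIV"
    and "(\<lambda>x. v x * laplacian u x) summable_on UNIV"
    and "(\<Sum>\<^sub>\<infinity>x. \<Sum>y | x \<sim> y. (u y - u x) * (v y - v x)) = - 2 * (\<Sum>\<^sub>\<infinity>x. v x * laplacian u x)"
proof -
  have translates: "square_summable (\<lambda>x. f (x + e))" if "square_summable f"
    for f :: "int ^ 'n \<Rightarrow> real" and e
    using that by (simp add: square_summable_translate)
  let ?F = "\<lambda>x y. v x * (u y - u x)"
  have "(\<lambda>x. v x * u (x + e) - v x * u x) summable_on UNIV" for e
    by (intro infsum_diff_real(1) summable_product translates u v)
  then have F: "(\<lambda>x. ?F x (x + e)) summable_on UNIV" for e
    by (simp only: right_diff_distrib)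
  note swap = edge_sum_swap[where F = ?F, OF F]
  have lap: "(\<Sum>y | x \<sim> y. ?F x y) = v x * laplacian u x" for x
    by (simp add: laplacian_def sum_distrib_left)
  have split: "(\<Sum>y | x \<sim> y. (u y - u x) * (v y - v x)) =
      - (\<Sum>y | x \<sim> y. ?F x y) - (\<Sum>y | x \<sim> y. ?F y x)" for x
    by (simp add: sum_negf[symmetric] sum_subtractf[symmetric] algebra_simps)
  have neg: "(\<lambda>x. - (\<Sum>y | x \<sim> y. ?F x y)) summable_on UNIV"
    using swap(1) by (simp add: summable_on_uminus)
  show "(\<lambda>x. v x * laplacian u x) summable_on UNIV"
    using swap(1) by (simp only: lap)
  show "(\<lambda>x. \<Sum>y | x \<sim> y. (u y - u x) * (v y - v x)) summable_on UNIV"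
    unfolding split by (rule infsum_diff_real(1)[OF neg swap(2)])
  show "(\<Sum>\<^sub>\<infinity>x. \<Sum>y | x \<sim> y. (u y - u x) * (v y - v x)) = - 2 * (\<Sum>\<^sub>\<infinity>x. v x * laplacian u x)"
    (is "?lhs = _")
  proof -
    have "?lhs = (\<Sum>\<^sub>\<infinity>x. - (\<Sum>y | x \<sim> y. ?F x y)) - (\<Sum>\<^sub>\<infinity>x. \<Sum>y | x \<sim> y. ?F y x)"
      unfolding split by (rule infsum_diff_real(2)[OF neg swap(2)])
    then show ?thesis
      unfolding swap(3) infsum_uminus lap by simp
  qed
qed

definition dirichlet :: "(int ^ 'n \<Rightarrow> real) \<Rightarrow> real"
  where "dirichlet u = (\<Sum>\<^sub>\<infinity>x. grad_sq u x)"

lemma grad_sq_nonneg: "0 \<le> grad_sq u x"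
  by (simp add: grad_sq_def sum_nonneg)

lemma grad_sq_summable:
  assumes "square_summable u"
  shows "grad_sq u summable_on UNIV"
  using summable_on_cmult_right[OF green(1)[OF assms assms], of "1 / 2"]
  by (simp add: grad_sq_def[abs_def] power2_eq_square)

lemma dirichlet_nonneg: "0 \<le> dirichlet u"
  unfolding dirichlet_def by (rule infsum_nonneg) (rule grad_sq_nonneg)

lemma dirichlet_add:
  fixes u v :: "int ^ 'n \<Rightarrow> real"
  assumes u: "square_summable u" and v: "square_summable v"
  shows "dirichlet (\<lambda>x. u x + v x) =
    dirichlet u + dirichlet v - 2 * (\<Sum>\<^sub>\<infinity>x. v x * laplacian u x)"
proof -
  let ?P = "\<lambda>x. \<Sum>y | x \<sim> y. (u y - u x) * (v y - v x)"
  have "grad_sq (\<lambda>x. u x + v x) x = grad_sq u x + grad_sq v x + ?P x" for x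
    by (simp add: grad_sq_def sum_distrib_left sum.distrib[symmetric] power2_eq_square algebra_simps)
  moreover have "((\<lambda>x. grad_sq u x + grad_sq v x + ?P x) has_sum
      dirichlet u + dirichlet v + infsum ?P UNIV) UNIV"
    unfolding dirichlet_def
    by (intro has_sum_add has_sum_infsum grad_sq_summable green(1) u v)
  ultimately have "(grad_sq (\<lambda>x. u x + v x) has_sum
      dirichlet u + dirichlet v + infsum ?P UNIV) UNIV"
    by (subst has_sum_cong)
  then have "dirichlet (\<lambda>x. u x + v x) = dirichlet u + dirichlet v + infsum ?P UNIV"
    unfolding dirichlet_def by (rule infsumI)
  then show ?thesis
    by (simp add: green(3)[OF u v])
qed

lemma dirichlet_scale: "dirichlet (\<lambda>x. c * u x) = c\<^sup>2 * dirichlet u"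
proof -
  have "(c * u y - c * u x)\<^sup>2 = c\<^sup>2 * (u y - u x)\<^sup>2" for x y
    by (simp add: right_diff_distrib[symmetric] power_mult_distrib)
  then have "grad_sq (\<lambda>x. c * u x) x = c\<^sup>2 * grad_sq u x" for x
    by (simp add: grad_sq_def sum_distrib_left[symmetric])
  then show ?thesis
    by (simp add: dirichlet_def infsum_cmult_right')
qed

lemma grad_sq_translate: "grad_sq (\<lambda>x. u (x + a)) x = grad_sq u (x + a)"
  by (simp add: grad_sq_def sum_neighbours add_ac)

lemma dirichlet_translate: "dirichlet (\<lambda>x. u (x + a)) = dirichlet u"
  by (simp add: dirichlet_def grad_sq_translate infsum_translate)

lemma dirichlet_abs_le:
  assumes "square_summable u"
  shows "dirichlet (\<lambda>x. \<bar>u x\<bar>) \<le> dirichlet u"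
  unfolding dirichlet_def
proof (rule infsum_mono)
  show "grad_sq (\<lambda>x. \<bar>u x\<bar>) summable_on UNIV"
    by (rule grad_sq_summable) (rule square_summable_dominated[OF assms], simp)
  show "grad_sq (\<lambda>x. \<bar>u x\<bar>) x \<le> grad_sq u x" for x
  proof -
    have "(\<bar>a\<bar> - \<bar>b\<bar>)\<^sup>2 \<le> (a - b)\<^sup>2" for a b :: real
      using abs_triangle_ineq3[of a b] abs_le_square_iff by blast
    then show ?thesis
      by (simp add: grad_sq_def sum_mono)
  qed
qed (rule grad_sq_summable[OF assms])

section \<open>The action functional\<close>

definition sq_ln :: "real \<Rightarrow> real"
  where "sq_ln s = s\<^sup>2 * ln (s\<^sup>2)"

lemma sq_ln_0 [simp]: "sq_ln 0 = 0"
  by (simp add: sq_ln_def)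

lemma sq_ln_abs [simp]: "sq_ln \<bar>s\<bar> = sq_ln s"
  by (simp add: sq_ln_def)

lemma sq_ln_mult: "sq_ln (c * s) = c\<^sup>2 * sq_ln s + c\<^sup>2 * ln (c\<^sup>2) * s\<^sup>2"
  by (cases "c = 0 \<or> s = 0")
    (auto simp: sq_ln_def power_mult_distrib ln_mult algebra_simps)

lemma sq_ln_nonpos: "s\<^sup>2 \<le> 1 \<Longrightarrow> sq_ln s \<le> 0"
  by (cases "s = 0") (auto simp: sq_ln_def mult_nonneg_nonpos)

text \<open>At zero the factor \<open>s\<close> left over in the difference quotient absorbs the logarithm.\<close>

lemma DERIV_sq_ln: "(sq_ln has_real_derivative 2 * s * ln (s\<^sup>2) + 2 * s) (at s)"
proof (cases "s = 0")
  case True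
  have "((\<lambda>h::real. h * ln (h\<^sup>2)) \<longlongrightarrow> 0) (at 0)"
    by real_asymp
  moreover have "sq_ln (0 + h) / h = h * ln (h\<^sup>2)" for h
    by (simp add: sq_ln_def power2_eq_square)
  ultimately show ?thesis
    using True by (simp add: DERIV_def)
next
  case False
  then show ?thesis
    unfolding sq_ln_def[abs_def]
    by (auto intro!: derivative_eq_intros simp: field_simps power2_eq_square zero_less_mult_iff)
qed

lemma isCont_sq_ln: "isCont sq_ln s"
  using DERIV_sq_ln by (rule DERIV_isCont)

text \<open>For a bounded potential, these are exactly the functions of finite energy.\<close>

definition admissible :: "('a \<Rightarrow> real) \<Rightarrow> bool"
  where "admissible u \<longleftrightarrow> square_summable u \<and> (\<lambda>x. sq_ln (u x)) summable_on UNIV"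

text \<open>For a bounded potential, the energy of an admissible function is half the sum of its action and
  its mass, and the Nehari manifold consists of the nonzero admissible functions with action 0. For
  a unit vector \<open>u\<close>, the action consists of the Dirichlet energy, the potential energy and the
  Shannon entropy of the probability distribution \<open>u\<^sup>2\<close>.\<close>

definition action :: "(int ^ 'n \<Rightarrow> real) \<Rightarrow> (int ^ 'n \<Rightarrow> real) \<Rightarrow> real"
  where "action V u = dirichlet u + (\<Sum>\<^sub>\<infinity>x. V x * (u x)\<^sup>2) - (\<Sum>\<^sub>\<infinity>x. sq_ln (u x))"

lemma admissibleD:
  assumes "admissible u"
  shows "square_summable u" and "(\<lambda>x. sq_ln (u x)) summable_on UNIV"
  using assms by (auto simp: admissible_def)

lemma potential_summable:
  assumes "bounded (range V)" and "square_summable u"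
  shows "(\<lambda>x. V x * (u x)\<^sup>2) summable_on UNIV"
proof -
  obtain C where C: "\<And>x. \<bar>V x\<bar> \<le> C"
    using assms(1) by (auto simp: bounded_iff)
  show ?thesis
  proof (rule summable_on_dominated)
    show "(\<lambda>x. C * (u x)\<^sup>2) summable_on UNIV"
      using assms(2) unfolding square_summable_def by (rule summable_on_cmult_right)
    show "\<bar>V x * (u x)\<^sup>2\<bar> \<le> C * (u x)\<^sup>2" for x
      using C[of x] by (simp add: abs_mult mult_right_mono)
  qed
qed

lemma admissible_scale:
  assumes "admissible u"
  shows "admissible (\<lambda>x. c * u x)"
  unfolding admissible_def sq_ln_mult
  using admissibleD[OF assms, unfolded square_summable_def]
  by (auto intro!: summable_on_add summable_on_cmult_right square_summable_scale
      admissibleD(1)[OF assms])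

lemma action_scale:
  assumes "admissible u"
  shows "action V (\<lambda>x. c * u x) = c\<^sup>2 * (action V u - ln (c\<^sup>2) * mass u)"
proof -
  have "(\<Sum>\<^sub>\<infinity>x. sq_ln (c * u x)) = c\<^sup>2 * (\<Sum>\<^sub>\<infinity>x. sq_ln (u x)) + c\<^sup>2 * ln (c\<^sup>2) * mass u"
    unfolding sq_ln_mult mass_def infsum_cmult_right'[symmetric]
    using admissibleD[OF assms, unfolded square_summable_def]
    by (intro infsum_add summable_on_cmult_right)
  moreover have "(\<Sum>\<^sub>\<infinity>x. V x * (c * u x)\<^sup>2) = c\<^sup>2 * (\<Sum>\<^sub>\<infinity>x. V x * (u x)\<^sup>2)"
    unfolding infsum_cmult_right'[symmetric] by (simp add: power_mult_distrib mult_ac)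
  ultimately show ?thesis
    by (simp add: action_def dirichlet_scale algebra_simps)
qed

lemma admissible_translate:
  fixes u :: "'a::group_add \<Rightarrow> real"
  shows "admissible (\<lambda>x. u (x + a)) \<longleftrightarrow> admissible u"
  using summable_on_translate[of "\<lambda>x. sq_ln (u x)" a]
  by (simp add: admissible_def square_summable_translate)

lemma action_translate: "action (\<lambda>x. V (x + a)) (\<lambda>x. u (x + a)) = action V u"
  using infsum_translate[of "\<lambda>x. sq_ln (u x)" a] infsum_translate[of "\<lambda>x. V x * (u x)\<^sup>2" a]
  by (simp add: action_def dirichlet_translate)

lemma admissible_abs: "admissible (\<lambda>x. \<bar>u x\<bar>) \<longleftrightarrow> admissible u"
  by (simp add: admissible_def square_summable_def)

lemma action_abs_le:
  assumes "square_summable u"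
  shows "action V (\<lambda>x. \<bar>u x\<bar>) \<le> action V u"
  using dirichlet_abs_le[OF assms] by (simp add: action_def)

definition restrict_to :: "'a set \<Rightarrow> ('a \<Rightarrow> real) \<Rightarrow> 'a \<Rightarrow> real"
  where "restrict_to S u x = (if x \<in> S then u x else 0)"

lemma square_summable_restrict:
  assumes "square_summable u"
  shows "square_summable (restrict_to S u)"
  by (rule square_summable_dominated[OF assms]) (simp add: restrict_to_def)

lemma infsum_restrict_split:
  fixes g :: "'a \<Rightarrow> real \<Rightarrow> real"
  assumes g: "(\<lambda>x. g x (u x)) summable_on UNIV" and g0: "\<And>x. g x 0 = 0"
  shows "(\<lambda>x. g x (restrict_to S u x)) summable_on UNIV"
    and "(\<Sum>\<^sub>\<infinity>x. g x (u x)) =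
      (\<Sum>\<^sub>\<infinity>x. g x (restrict_to S u x)) + (\<Sum>\<^sub>\<infinity>x. g x (restrict_to (- S) u x))"
proof -
  have "(\<lambda>x. \<bar>g x (u x)\<bar>) summable_on UNIV"
    using summable_on_iff_abs_summable_on_real[THEN iffD1, OF g] by simp
  then have part: "(\<lambda>x. g x (restrict_to T u x)) summable_on UNIV" for T
    by (rule summable_on_dominated) (simp add: restrict_to_def g0)
  then show "(\<lambda>x. g x (restrict_to S u x)) summable_on UNIV" .
  have "g x (u x) = g x (restrict_to S u x) + g x (restrict_to (- S) u x)" for x
    by (simp add: restrict_to_def g0)
  then show "(\<Sum>\<^sub>\<infinity>x. g x (u x)) =
      (\<Sum>\<^sub>\<infinity>x. g x (restrict_to S u x)) + (\<Sum>\<^sub>\<infinity>x. g x (restrict_to (- S) u x))"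
    using infsum_add[OF part[of S] part[of "- S"]] by simp
qed

lemma admissible_restrict:
  assumes "admissible u"
  shows "admissible (restrict_to S u)"
  using infsum_restrict_split(1)[of "\<lambda>_. sq_ln" u S] admissibleD[OF assms]
  by (simp add: admissible_def square_summable_restrict)

lemma mass_restrict_finite:
  assumes "finite F"
  shows "mass (restrict_to F u) = (\<Sum>x\<in>F. (u x)\<^sup>2)"
proof -
  have "mass (restrict_to F u) = (\<Sum>\<^sub>\<infinity>x\<in>F. (u x)\<^sup>2)"
    unfolding mass_def by (rule infsum_cong_neutral) (auto simp: restrict_to_def)
  with assms show ?thesis
    by simp
qed

lemma mass_restrict_cofinite:
  assumes "square_summable u" and "finite F"
  shows "mass (restrict_to (- F) u) = mass u - (\<Sum>x\<in>F. (u x)\<^sup>2)"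
  using infsum_restrict_split(2)[of "\<lambda>_ s. s\<^sup>2" u F] assms mass_restrict_finite[OF assms(2), of u]
  by (simp add: mass_def square_summable_def)

text \<open>The interaction between the parts of \<open>u\<close> inside and outside \<open>F\<close>; each edge that leaves \<open>F\<close> is
  counted once, from its inner end.\<close>

definition cut_weight :: "(int ^ 'n) set \<Rightarrow> (int ^ 'n \<Rightarrow> real) \<Rightarrow> real"
  where "cut_weight F u = (\<Sum>x\<in>F. u x * (\<Sum>y | x \<sim> y. restrict_to (- F) u y))"

text \<open>The parts of the action without differences are additive over disjoint supports, and by
  summation by parts the Dirichlet energy differs from the sum only by the products across the
  edges that are cut.\<close>

lemma action_cut:
  fixes u :: "int ^ 'n \<Rightarrow> real"
  assumes V: "bounded (range V)" and u: "admissible u" and F: "finite F"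
  shows "action V u = action V (restrict_to F u) + action V (restrict_to (- F) u)
    - 2 * cut_weight F u"
proof -
  let ?i = "restrict_to F u" and ?o = "restrict_to (- F) u"
  have "(\<lambda>x. ?o x + ?i x) = u"
    by (auto simp: restrict_to_def)
  then have "dirichlet u = dirichlet ?i + dirichlet ?o - 2 * (\<Sum>\<^sub>\<infinity>x. ?i x * laplacian ?o x)"
    using dirichlet_add[of ?o ?i] admissibleD(1)[OF u] by (simp add: square_summable_restrict)
  moreover have "(\<Sum>\<^sub>\<infinity>x. ?i x * laplacian ?o x) = (\<Sum>\<^sub>\<infinity>x\<in>F. u x * (\<Sum>y | x \<sim> y. ?o y))"
    by (rule infsum_cong_neutral) (auto simp: restrict_to_def laplacian_def)
  ultimately show ?thesis
    using F infsum_restrict_split(2)[of "\<lambda>_. sq_ln" u F]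
      infsum_restrict_split(2)[of "\<lambda>x s. V x * s\<^sup>2" u F]
      potential_summable[OF V admissibleD(1)[OF u]] admissibleD(2)[OF u]
    by (simp add: action_def cut_weight_def)
qed

section \<open>A logarithmic Sobolev inequality\<close>

text \<open>The lower bound is the value forced by homogeneity when the action is at least \<open>m\<close> on the
  unit sphere; the term with the logarithm makes it strictly subadditive in the mass.\<close>

definition log_sobolev :: "(int ^ 'n \<Rightarrow> real) \<Rightarrow> real \<Rightarrow> bool"
  where "log_sobolev V m \<longleftrightarrow>
    (\<forall>w. admissible w \<longrightarrow> m * mass w - mass w * ln (mass w) \<le> action V w)"

text \<open>If no entry of the distribution \<open>u\<^sup>2\<close> exceeds \<open>\<delta>\<close>, its Shannon entropy is at least
  \<open>- ln \<delta>\<close>. So a sequence of bounded action cannot flatten out.\<close>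

lemma action_ge_entropy:
  fixes u :: "int ^ 'n \<Rightarrow> real"
  assumes V: "\<And>x. \<bar>V x\<bar> \<le> C" and u: "admissible u" and mass: "mass u = 1"
    and small: "\<And>x. (u x)\<^sup>2 \<le> \<delta>"
  shows "- C - ln \<delta> \<le> action V u"
proof -
  note squares = admissibleD(1)[OF u, unfolded square_summable_def]
  have "bounded (range V)"
    using V by (auto simp: bounded_iff)
  from potential_summable[OF this admissibleD(1)[OF u]]
  have "(\<Sum>\<^sub>\<infinity>x. - C * (u x)\<^sup>2) \<le> (\<Sum>\<^sub>\<infinity>x. V x * (u x)\<^sup>2)"
  proof (rule infsum_mono[OF summable_on_cmult_right[OF squares]])
    show "- C * (u x)\<^sup>2 \<le> V x * (u x)\<^sup>2" for x
      by (rule mult_right_mono) (use V[of x] in auto)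
  qed
  moreover have "(\<Sum>\<^sub>\<infinity>x. sq_ln (u x)) \<le> (\<Sum>\<^sub>\<infinity>x. ln \<delta> * (u x)\<^sup>2)"
  proof (rule infsum_mono[OF admissibleD(2)[OF u] summable_on_cmult_right[OF squares]])
    show "sq_ln (u x) \<le> ln \<delta> * (u x)\<^sup>2" for x
    proof (cases "u x = 0")
      case False
      then have "ln ((u x)\<^sup>2) \<le> ln \<delta>"
        using small[of x] zero_less_power2[of "u x"] by (intro ln_mono) auto
      then have "ln ((u x)\<^sup>2) * (u x)\<^sup>2 \<le> ln \<delta> * (u x)\<^sup>2"
        by (rule mult_right_mono) simp
      then show ?thesis
        by (simp add: sq_ln_def mult.commute)
    qed simp
  qed
  moreover have "(\<Sum>\<^sub>\<infinity>x. c * (u x)\<^sup>2) = c" for c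
    using mass by (simp add: infsum_cmult_right' mass_def)
  ultimately show ?thesis
    using dirichlet_nonneg[of u] by (simp only: action_def)
qed

text \<open>Every nonzero function is a multiple of a unit vector, so the infimum of the action over the
  unit sphere serves as \<open>m\<close>.\<close>

lemma log_sobolev_optimal:
  fixes V :: "int ^ 'n \<Rightarrow> real"
  assumes V: "bounded (range V)"
  obtains m where "log_sobolev V m"
    and "\<And>\<epsilon>. 0 < \<epsilon> \<Longrightarrow> \<exists>u. admissible u \<and> mass u = 1 \<and> action V u < m + \<epsilon>"
proof
  obtain C where C: "\<And>x. \<bar>V x\<bar> \<le> C"
    using V by (auto simp: bounded_iff)
  let ?S = "{u. admissible u \<and> mass u = 1} :: (int ^ 'n \<Rightarrow> real) set"
  define m where "m = Inf (action V ` ?S)"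
  have "- C \<le> action V u" if "u \<in> ?S" for u
    using action_ge_entropy[OF C, of u 1] that square_le_mass[of u] by (simp add: admissible_def)
  then have bdd: "bdd_below (action V ` ?S)"
    by (auto intro!: bdd_belowI)
  have "restrict_to {0} (\<lambda>_. 1) \<in> ?S"
  proof -
    have "finite {x. restrict_to {0} (\<lambda>_. 1) x \<noteq> (0 :: real)}"
      by (rule finite_subset[of _ "{0}"]) (auto simp: restrict_to_def)
    then show ?thesis
      by (auto simp: admissible_def mass_restrict_finite intro!: square_summable_finite_support
          finite_nonzero_values_imp_summable_on elim!: rev_finite_subset)
  qed
  then have nonempty: "action V ` ?S \<noteq> {}"
    by blast
  show "\<exists>u. admissible u \<and> mass u = 1 \<and> action V u < m + \<epsilon>" if "0 < \<epsilon>" for \<epsilon>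
    using cInf_lessD[OF nonempty, of "m + \<epsilon>"] that by (auto simp: m_def)
  show "log_sobolev V m"
    unfolding log_sobolev_def
  proof (intro allI impI)
    fix w :: "int ^ 'n \<Rightarrow> real"
    assume w: "admissible w"
    show "m * mass w - mass w * ln (mass w) \<le> action V w"
    proof (cases "mass w = 0")
      case True
      then have "w = (\<lambda>_. 0)"
        using mass_eq_0_iff admissibleD(1)[OF w] by blast
      then show ?thesis
        by (simp add: mass_def action_def dirichlet_def grad_sq_def)
    next
      case False
      then have pos: "0 < mass w"
        using mass_nonneg[of w] by simp
      define c where "c = 1 / sqrt (mass w)"
      have c: "c\<^sup>2 = 1 / mass w"
        using pos by (simp add: c_def power_divide)
      then have "(\<lambda>x. c * w x) \<in> ?S"
        using pos admissible_scale[OF w] by (simp add: mass_scale)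
      then have "m \<le> action V (\<lambda>x. c * w x)"
        unfolding m_def by (rule cINF_lower[OF bdd])
      then show ?thesis
        using pos by (simp add: action_scale[OF w] c ln_div field_simps)
    qed
  qed
qed

lemma log_sobolev_unit: "log_sobolev V m \<Longrightarrow> admissible u \<Longrightarrow> mass u = 1 \<Longrightarrow> m \<le> action V u"
  by (fastforce simp: log_sobolev_def)

lemma log_sobolev_translate:
  fixes V :: "int ^ 'n \<Rightarrow> real"
  assumes "log_sobolev V m"
  shows "log_sobolev (\<lambda>x. V (x + a)) m"
  unfolding log_sobolev_def
proof (intro allI impI)
  fix w :: "int ^ 'n \<Rightarrow> real"
  assume "admissible w"
  then have "admissible (\<lambda>x. w (x + - a))"
    by (simp only: admissible_translate)
  with assms have "m * mass w - mass w * ln (mass w) \<le> action V (\<lambda>x. w (x + - a))"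
    by (auto simp: log_sobolev_def mass_translate simp del: add_uminus_conv_diff)
  then show "m * mass w - mass w * ln (mass w) \<le> action (\<lambda>x. V (x + a)) w"
    using action_translate[of V a "\<lambda>x. w (x + - a)"] by simp
qed

section \<open>No loss of mass\<close>

text \<open>Splitting the unit mass into \<open>a\<close> and \<open>1 - a\<close> costs the entropy
  \<open>- a ln a - (1 - a) ln (1 - a)\<close>, which is at least \<open>2 a (1 - a)\<close> as \<open>ln t \<le> t - 1\<close>.\<close>

lemma split_cost:
  assumes V: "bounded (range V)" and m: "log_sobolev V m"
    and u: "admissible u" and mass: "mass u = 1" and F: "finite F"
  defines "a \<equiv> \<Sum>x\<in>F. (u x)\<^sup>2"
  shows "m + 2 * a * (1 - a) - 2 * cut_weight F u \<le> action V u"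
proof -
  let ?i = "restrict_to F u" and ?o = "restrict_to (- F) u"
  have entropy: "t * (1 - t) \<le> - t * ln t" if "0 \<le> t" for t :: real
  proof (cases "t = 0")
    case False
    then show ?thesis
      using that ln_le_minus_one[of t] mult_left_mono[of "ln t" "t - 1" t]
      by (simp add: algebra_simps)
  qed simp
  have i: "mass ?i = a" and o: "mass ?o = 1 - a"
    using mass_restrict_finite[OF F] mass_restrict_cofinite[OF admissibleD(1)[OF u] F] mass
    by (simp_all add: a_def)
  have "m * a - a * ln a \<le> action V ?i" and "m * (1 - a) - (1 - a) * ln (1 - a) \<le> action V ?o"
    using m[unfolded log_sobolev_def, rule_format, OF admissible_restrict[OF u]] i o by metis+
  moreover have "a * (1 - a) \<le> - a * ln a" and "(1 - a) * a \<le> - (1 - a) * ln (1 - a)"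
    using entropy[of a] entropy[of "1 - a"] mass_nonneg[of ?i] mass_nonneg[of ?o] i o by simp_all
  ultimately show ?thesis
    unfolding action_cut[OF V u F] by (simp add: algebra_simps)
qed

text \<open>Young's inequality with weight \<open>\<eta>\<close> separates the two ends of each cut edge. The outer ends
  carry only the mass outside \<open>F\<close>, so the bound becomes arbitrarily small when first \<open>\<eta>\<close> is
  chosen small and then \<open>F\<close> large.\<close>

lemma cut_weight_le:
  fixes u :: "int ^ 'n \<Rightarrow> real"
  assumes u: "square_summable u" and F: "finite F" and \<eta>: "0 < \<eta>"
  shows "cut_weight F u \<le> real (card (unit_vectors :: (int ^ 'n) set)) *
    ((\<eta> * mass u + (mass u - (\<Sum>x\<in>F. (u x)\<^sup>2)) / \<eta>) / 2)"
proof -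
  let ?o = "restrict_to (- F) u"
  have o: "square_summable ?o"
    using u by (rule square_summable_restrict)
  have young: "s * t \<le> (\<eta> * s\<^sup>2 + t\<^sup>2 / \<eta>) / 2" for s t
  proof -
    have "0 \<le> (\<eta> * s - t)\<^sup>2 / \<eta>"
      using \<eta> by simp
    also have "(\<eta> * s - t)\<^sup>2 / \<eta> = \<eta> * s\<^sup>2 + t\<^sup>2 / \<eta> - 2 * (s * t)"
      using \<eta> by (simp add: power2_eq_square field_simps)
    finally show ?thesis
      by simp
  qed
  have "cut_weight F u = (\<Sum>e\<in>unit_vectors. \<Sum>x\<in>F. u x * ?o (x + e))"
    unfolding cut_weight_def sum_neighbours sum_distrib_left by (rule sum.swap)
  also have "\<dots> \<le> (\<Sum>e\<in>(unit_vectors :: (int ^ 'n) set). (\<eta> * mass u + mass ?o / \<eta>) / 2)"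
  proof (rule sum_mono)
    fix e :: "int ^ 'n"
    have "(\<Sum>x\<in>F. u x * ?o (x + e)) \<le> (\<Sum>x\<in>F. (\<eta> * (u x)\<^sup>2 + (?o (x + e))\<^sup>2 / \<eta>) / 2)"
      by (rule sum_mono) (rule young)
    also have "\<dots> = (\<eta> * (\<Sum>x\<in>F. (u x)\<^sup>2) + (\<Sum>x\<in>F. (?o (x + e))\<^sup>2) / \<eta>) / 2"
      by (simp add: sum.distrib sum_distrib_left sum_divide_distrib add_divide_distrib)
    also have "\<dots> \<le> (\<eta> * mass u + mass ?o / \<eta>) / 2"
    proof -
      have "(\<Sum>x\<in>F. (?o (x + e))\<^sup>2) \<le> mass ?o"
        using sum_squares_le_mass[of "\<lambda>x. ?o (x + e)" F] o F
        by (simp add: square_summable_translate mass_translate)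
      then show ?thesis
        using sum_squares_le_mass[OF u F] \<eta>
        by (intro divide_right_mono add_mono mult_left_mono) auto
    qed
    finally show "(\<Sum>x\<in>F. u x * ?o (x + e)) \<le> (\<eta> * mass u + mass ?o / \<eta>) / 2" .
  qed
  finally show ?thesis
    by (simp add: mass_restrict_cofinite[OF u F])
qed

text \<open>In the limit along the sequence, the cost of splitting shows \<open>a (1 - a) \<le> cut_weight F v\<close> for
  the mass \<open>a\<close> of \<open>v\<close> on any finite set \<open>F\<close>. When \<open>F\<close> grows, the weight of the cut vanishes, so
  the mass of \<open>v\<close> is 0 or 1, and it is not 0.\<close>

lemma limit_mass_eq_1:
  fixes v :: "int ^ 'n \<Rightarrow> real"
  assumes V: "\<And>n. bounded (range (V n))" and m: "\<And>n. log_sobolev (V n) m"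
    and u: "\<And>n. admissible (u n)" and mass: "\<And>n. mass (u n) = 1"
    and action: "(\<lambda>n. action (V n) (u n)) \<longlonglongrightarrow> m"
    and lim: "\<And>x. (\<lambda>n. u n x) \<longlonglongrightarrow> v x" and nz: "v \<noteq> (\<lambda>_. 0)"
  shows "square_summable v" and "mass v = 1"
proof -
  have "(\<lambda>x. (v x)\<^sup>2) summable_on UNIV \<and> infsum (\<lambda>x. (v x)\<^sup>2) UNIV \<le> 1"
  proof (rule infsum_Fatou)
    show "(\<lambda>n. (u n x)\<^sup>2) \<longlonglongrightarrow> (v x)\<^sup>2" for x
      by (intro tendsto_intros lim)
    show "(\<lambda>n. \<Sum>\<^sub>\<infinity>x. (u n x)\<^sup>2) \<longlonglongrightarrow> 1"
      using mass by (simp add: mass_def)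
    show "(\<lambda>x. (u n x)\<^sup>2) summable_on UNIV" for n
      using u by (simp add: admissible_def square_summable_def)
  qed simp
  then have squares: "(\<lambda>x. (v x)\<^sup>2) summable_on UNIV" "infsum (\<lambda>x. (v x)\<^sup>2) UNIV \<le> 1"
    by auto
  then show v: "square_summable v"
    by (simp add: square_summable_def)
  have le1: "mass v \<le> 1"
    using squares(2) by (simp add: mass_def)
  let ?a = "\<lambda>F. \<Sum>x\<in>F. (v x)\<^sup>2" and ?d = "real (card (unit_vectors :: (int ^ 'n) set))"
  have cut: "?a F * (1 - ?a F) \<le> cut_weight F v" if F: "finite F" for F
  proof -
    have "(\<lambda>n. m + 2 * (\<Sum>x\<in>F. (u n x)\<^sup>2) * (1 - (\<Sum>x\<in>F. (u n x)\<^sup>2)) - 2 * cut_weight F (u n))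
        \<longlonglongrightarrow> m + 2 * ?a F * (1 - ?a F) - 2 * cut_weight F v"
      unfolding cut_weight_def restrict_to_def
      by (intro tendsto_intros lim) (auto intro: lim)
    then have "m + 2 * ?a F * (1 - ?a F) - 2 * cut_weight F v \<le> m"
      by (rule LIMSEQ_le[OF _ action]) (use split_cost[OF V m u mass F] in auto)
    then show ?thesis
      by simp
  qed
  have deficit: "1 - mass v \<le> ?d * \<eta> / 2" if \<eta>: "0 < \<eta>" for \<eta>
  proof -
    let ?Fin = "finite_subsets_at_top (UNIV :: (int ^ 'n) set)"
    have a: "(?a \<longlongrightarrow> mass v) ?Fin"
      unfolding mass_def by (rule infsum_tendsto[OF squares(1)])
    have "mass v * (1 - mass v) \<le> ?d * ((\<eta> * mass v + (mass v - mass v) / \<eta>) / 2)"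
    proof (rule tendsto_le[OF finite_subsets_at_top_neq_bot])
      show "((\<lambda>F. ?a F * (1 - ?a F)) \<longlongrightarrow> mass v * (1 - mass v)) ?Fin"
        by (intro tendsto_intros a)
      show "((\<lambda>F. ?d * ((\<eta> * mass v + (mass v - ?a F) / \<eta>) / 2)) \<longlongrightarrow>
          ?d * ((\<eta> * mass v + (mass v - mass v) / \<eta>) / 2)) ?Fin"
        using \<eta> by (intro tendsto_intros a) auto
      show "\<forall>\<^sub>F F in ?Fin. ?a F * (1 - ?a F) \<le> ?d * ((\<eta> * mass v + (mass v - ?a F) / \<eta>) / 2)"
        using cut cut_weight_le[OF v _ \<eta>]
        by (intro eventually_finite_subsets_at_top_weakI) (meson order_trans)
    qed
    then have "mass v * (1 - mass v) \<le> mass v * (?d * \<eta> / 2)"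
      by (simp add: mult_ac)
    then show ?thesis
      using mass_pos[OF v nz] by (rule mult_left_le_imp_le)
  qed
  have "1 - mass v \<le> \<epsilon>" if "0 < \<epsilon>" for \<epsilon>
  proof -
    have "1 - mass v \<le> ?d * (2 * \<epsilon> / (?d + 1)) / 2"
      using that by (intro deficit) simp
    also have "\<dots> \<le> \<epsilon>"
      using that by (simp add: field_simps)
    finally show ?thesis .
  qed
  then have "1 - mass v \<le> 0"
    by (rule field_le_epsilon) simp
  with le1 show "mass v = 1"
    by simp
qed

text \<open>Adding a multiple of the mass makes all terms of the action nonnegative, so that Fatou's lemma
  applies, and no mass is lost in the limit.\<close>

lemma action_limit_le:
  fixes v :: "int ^ 'n \<Rightarrow> real"
  assumes C: "\<And>n x. \<bar>V n x\<bar> \<le> C"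
    and u: "\<And>n. admissible (u n)" and mass: "\<And>n. mass (u n) = 1"
    and action: "(\<lambda>n. action (V n) (u n)) \<longlonglongrightarrow> m"
    and lim: "\<And>x. (\<lambda>n. u n x) \<longlonglongrightarrow> v x" and limV: "\<And>x. (\<lambda>n. V n x) \<longlonglongrightarrow> W x"
    and v: "square_summable v" "mass v = 1"
  shows "admissible v" and "action W v \<le> m"
proof -
  \<comment> \<open>The summand \<open>C (u x)\<^sup>2\<close> compensates a negative potential.\<close>
  let ?g = "\<lambda>V u x. grad_sq u x + V x * (u x)\<^sup>2 + C * (u x)\<^sup>2 - sq_ln (u x)"
  have W: "\<bar>W x\<bar> \<le> C" for x
    by (rule LIMSEQ_le_const2[OF tendsto_rabs[OF limV]]) (use C in auto)
  have bounded: "bounded (range X)" if "\<And>x. \<bar>X x\<bar> \<le> C" for X :: "int ^ 'n \<Rightarrow> real"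
    using that by (auto simp: bounded_iff)
  have base: "((\<lambda>x. grad_sq w x + X x * (w x)\<^sup>2 + C * (w x)\<^sup>2) has_sum
      dirichlet w + (\<Sum>\<^sub>\<infinity>x. X x * (w x)\<^sup>2) + C * mass w) UNIV"
    if "square_summable w" "\<And>x. \<bar>X x\<bar> \<le> C" for w X :: "int ^ 'n \<Rightarrow> real"
    using that potential_summable[OF bounded[OF that(2)] that(1)]
    unfolding dirichlet_def mass_def
    by (intro has_sum_add has_sum_infsum grad_sq_summable has_sum_cmult_right)
      (auto simp: square_summable_def)
  have has_sum: "(?g X w has_sum action X w + C * mass w) UNIV"
    if "admissible w" "\<And>x. \<bar>X x\<bar> \<le> C" for w X :: "int ^ 'n \<Rightarrow> real"
    using has_sum_add[OF base[of w X, OF admissibleD(1)[OF that(1)] that(2)]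
        has_sum_uminusI[OF has_sum_infsum[OF admissibleD(2)[OF that(1)]]]]
    by (simp add: action_def algebra_simps)
  have "?g W v summable_on UNIV \<and> infsum (?g W v) UNIV \<le> m + C"
  proof (rule infsum_Fatou)
    show "(\<lambda>n. ?g (V n) (u n) x) \<longlonglongrightarrow> ?g W v x" for x
      unfolding grad_sq_def by (intro tendsto_intros lim limV isCont_tendsto_compose[OF isCont_sq_ln])
    show "0 \<le> ?g (V n) (u n) x" for n x
    proof -
      have "0 \<le> V n x + C"
        using C[of n x] by simp
      then have "0 \<le> (V n x + C) * (u n x)\<^sup>2"
        by simp
      moreover have "(u n x)\<^sup>2 \<le> 1"
        using square_le_mass[OF admissibleD(1)[OF u], of n x] mass by simp
      ultimately show ?thesis
        using grad_sq_nonneg[of "u n" x] sq_ln_nonpos[of "u n x"] by (simp add: distrib_right)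
    qed
    show "?g (V n) (u n) summable_on UNIV" for n
      using has_sum[OF u[of n] C[of n]] by (auto simp: has_sum_iff)
    have "infsum (?g (V n) (u n)) UNIV = action (V n) (u n) + C" for n
      using has_sum[OF u[of n] C[of n]] mass by (auto simp: has_sum_iff)
    then show "(\<lambda>n. infsum (?g (V n) (u n)) UNIV) \<longlonglongrightarrow> m + C"
      using action by (simp add: tendsto_add)
  qed
  then have g: "?g W v summable_on UNIV" "infsum (?g W v) UNIV \<le> m + C"
    by auto
  have "(\<lambda>x. (grad_sq v x + W x * (v x)\<^sup>2 + C * (v x)\<^sup>2) - ?g W v x) summable_on UNIV"
    by (rule infsum_diff_real(1)[OF has_sum_imp_summable[OF base[of v W, OF v(1) W]] g(1)])
  then show admissible: "admissible v"
    by (simp add: admissible_def v(1))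
  show "action W v \<le> m"
    using has_sum[of v W, OF admissible W] g(2) v(2) by (auto simp: has_sum_iff)
qed

section \<open>Existence of a minimiser\<close>

lemma cofinite_le_lattice_at_infinity: "cofinite \<le> (lattice_at_infinity :: (int ^ 'n) filter)"
proof (rule filter_leI)
  fix P :: "int ^ 'n \<Rightarrow> bool"
  assume "eventually P lattice_at_infinity"
  then obtain R where R: "\<And>x. R \<le> lattice_norm x \<Longrightarrow> P x"
    by (auto simp: lattice_at_infinity_def eventually_filtercomap eventually_at_top_linorder)
  have "x $ i \<in> {- \<lceil>R\<rceil> .. \<lceil>R\<rceil>}" if "\<not> P x" for x i
  proof -
    have "\<bar>real_of_int (x $ i)\<bar> \<le> lattice_norm x"
      using component_le_norm_cart[of "\<chi> i. real_of_int (x $ i)" i] by (simp add: lattice_norm_def)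
    also have "lattice_norm x < R"
      using R that by force
    finally have "real_of_int \<bar>x $ i\<bar> < of_int \<lceil>R\<rceil>"
      using le_of_int_ceiling[of R] by linarith
    then show ?thesis
      by auto
  qed
  then have "vec_nth ` {x. \<not> P x} \<subseteq> (\<Pi>\<^sub>E i\<in>UNIV. {- \<lceil>R\<rceil> .. \<lceil>R\<rceil>})"
    by (auto simp: PiE_UNIV_domain)
  then have "finite (vec_nth ` {x. \<not> P x})"
    by (rule finite_subset) (auto intro: finite_PiE)
  then show "eventually P cofinite"
    by (auto simp: eventually_cofinite inj_on_def vec_nth_inject elim: finite_imageD)
qed

text \<open>Along a subsequence the centres either stay put or leave every finite set. In the second
  case the limiting potential is the constant \<open>L\<close>, which dominates \<open>V\<close>.\<close>

lemma translated_potentials_converge: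
  fixes V :: "int ^ 'n \<Rightarrow> real" and z :: "nat \<Rightarrow> int ^ 'n"
  assumes "(V \<longlongrightarrow> L) lattice_at_infinity" and "\<And>x. V x \<le> L"
  obtains k :: "nat \<Rightarrow> nat" and W a where "strict_mono k"
    and "\<And>x. (\<lambda>n. V (x + z (k n))) \<longlonglongrightarrow> W x" and "\<And>x. V (x + a) \<le> W x"
proof (cases "\<exists>a. infinite {n. z n = a}")
  case True
  then obtain a where "infinite {n. z n = a}"
    by blast
  then obtain k :: "nat \<Rightarrow> nat" where "strict_mono k" and "\<And>n. z (k n) = a"
    using infinite_enumerate[of "{n. z n = a}"] by auto
  then show ?thesis
    using that[of k "\<lambda>x. V (x + a)" a] by simp
next
  case False
  have "(\<lambda>n. V (x + z n)) \<longlonglongrightarrow> L" for x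
  proof (rule filterlim_compose[where g = V and f = "\<lambda>n. x + z n"])
    show "(V \<longlongrightarrow> L) cofinite"
      by (rule tendsto_mono[OF cofinite_le_lattice_at_infinity assms(1)])
    show "filterlim (\<lambda>n. x + z n) cofinite sequentially"
      unfolding filterlim_iff
    proof (intro allI impI)
      fix P :: "int ^ 'n \<Rightarrow> bool"
      assume "eventually P cofinite"
      then have "finite (\<Union>y\<in>{y. \<not> P y}. {n. z n = y - x})"
        using False by (auto simp: eventually_cofinite)
      moreover have "{n. \<not> P (x + z n)} \<subseteq> (\<Union>y\<in>{y. \<not> P y}. {n. z n = y - x})"
        by auto
      ultimately show "\<forall>\<^sub>F n in sequentially. P (x + z n)"
        unfolding cofinite_eq_sequentially[symmetric] eventually_cofinite by (rule rev_finite_subset)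
    qed
  qed
  then show ?thesis
    using that[of id "\<lambda>_. L" 0] assms(2) by (simp add: strict_mono_id)
qed

text \<open>A minimising sequence keeps a definite mass at some vertex by the entropy bound. Moving this
  vertex to the origin gives a nonzero limit, which has mass 1. It minimises the action of the
  limiting potential, and a translate of it that of \<open>V\<close>, as \<open>V\<close> is the smaller potential.\<close>

lemma minimiser_exists:
  fixes V :: "int ^ 'n \<Rightarrow> real"
  assumes V: "bounded (range V)" and "(V \<longlongrightarrow> L) lattice_at_infinity" and "\<And>x. V x \<le> L"
  obtains m u where "log_sobolev V m" and "admissible u" and "mass u = 1"
    and "action V u = m" and "\<And>x. 0 \<le> u x"
proof -
  obtain C where C: "\<And>x. \<bar>V x\<bar> \<le> C"
    using V by (auto simp: bounded_iff)
  obtain m where m: "log_sobolev V m"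
    and "\<And>\<epsilon>. 0 < \<epsilon> \<Longrightarrow> \<exists>u. admissible u \<and> mass u = 1 \<and> action V u < m + \<epsilon>"
    using log_sobolev_optimal[OF V] by blast
  from this(2)[of "1 / real (Suc n)" for n]
  have "\<forall>n. \<exists>u. admissible u \<and> mass u = 1 \<and> action V u < m + 1 / real (Suc n)"
    by simp
  then obtain w :: "nat \<Rightarrow> int ^ 'n \<Rightarrow> real" where w: "\<And>n. admissible (w n)" "\<And>n. mass (w n) = 1"
    and upper: "\<And>n. action V (w n) < m + 1 / real (Suc n)"
    by metis
  have action: "(\<lambda>n. action V (w n)) \<longlonglongrightarrow> m"
  proof (rule tendsto_sandwich)
    show "\<forall>\<^sub>F n in sequentially. m \<le> action V (w n)"
      using log_sobolev_unit[OF m w] by simp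
    show "\<forall>\<^sub>F n in sequentially. action V (w n) \<le> m + 1 / real (Suc n)"
      using upper by (simp add: less_imp_le)
    show "(\<lambda>n. m + 1 / real (Suc n)) \<longlonglongrightarrow> m"
      using tendsto_add[OF tendsto_const LIMSEQ_inverse_real_of_nat, of m]
      by (simp add: inverse_eq_divide)
  qed simp
  \<comment> \<open>With this threshold the entropy bound reads \<open>m + 1 \<le> action V (w n)\<close>.\<close>
  define \<delta> where "\<delta> = exp (- (C + m + 1))"
  have "\<exists>x. \<delta> < (w n x)\<^sup>2" for n
  proof (rule ccontr)
    assume "\<not> (\<exists>x. \<delta> < (w n x)\<^sup>2)"
    then have "m + 1 \<le> action V (w n)"
      using action_ge_entropy[OF C w, of n \<delta>] by (auto simp: \<delta>_def not_less)
    moreover have "1 / real (Suc n) \<le> 1"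
      by simp
    ultimately show False
      using upper[of n] by linarith
  qed
  then obtain z where z: "\<And>n. \<delta> < (w n (z n))\<^sup>2"
    by metis
  obtain k W a where k: "strict_mono k" and W: "\<And>x. (\<lambda>n. V (x + z (k n))) \<longlonglongrightarrow> W x"
    and dom: "\<And>x. V (x + a) \<le> W x"
    using translated_potentials_converge[OF assms(2,3)] by blast
  let ?w = "\<lambda>n x. w (k n) (x + z (k n))"
  have norm: "norm (?w n x) \<le> 1" for n x
    using square_le_mass[OF admissibleD(1)[OF w(1)], of "k n" "x + z (k n)"] w(2)
    by (simp add: abs_square_le_1)
  obtain j where j: "strict_mono j" and "\<And>x. \<exists>l. (\<lambda>n. ?w (j n) x) \<longlonglongrightarrow> l"
  proof (rule function_convergent_subsequence[of UNIV ?w 1])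
    show "norm (?w n x) \<le> 1" for n x
      by (rule norm)
  qed (auto intro: that)
  then obtain v where lim: "\<And>x. (\<lambda>n. ?w (j n) x) \<longlonglongrightarrow> v x"
    by metis
  let ?u = "\<lambda>n. ?w (j n)" and ?V = "\<lambda>n x. V (x + z (k (j n)))"
  have u: "\<And>n. admissible (?u n)" "\<And>n. mass (?u n) = 1"
    using w by (simp_all add: admissible_translate mass_translate)
  have actions: "(\<lambda>n. action (?V n) (?u n)) \<longlonglongrightarrow> m"
    unfolding action_translate
    using LIMSEQ_subseq_LIMSEQ[OF action strict_mono_o[OF k j]] by (simp add: o_def)
  have Vlim: "(\<lambda>n. ?V n x) \<longlonglongrightarrow> W x" for x
    using LIMSEQ_subseq_LIMSEQ[OF W j, of x] by (simp add: o_def)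
  have Vb: "bounded (range (?V n))" for n
    using C by (auto simp: bounded_iff)
  have "\<delta> \<le> (v 0)\<^sup>2"
    by (rule LIMSEQ_le_const[OF tendsto_power[OF lim]]) (use z in \<open>auto intro: less_imp_le\<close>)
  moreover have "0 < \<delta>"
    by (simp add: \<delta>_def)
  ultimately have nz: "v \<noteq> (\<lambda>_. 0)"
    by auto
  note v = limit_mass_eq_1[OF Vb log_sobolev_translate[OF m] u actions lim nz]
  note v' = action_limit_le[OF C u actions lim Vlim v]
  have Va: "bounded (range (\<lambda>x. V (x + a)))" and Wb: "bounded (range W)"
  proof -
    show "bounded (range (\<lambda>x. V (x + a)))"
      using C by (auto simp: bounded_iff)
    have "\<bar>W x\<bar> \<le> C" for x
      by (rule LIMSEQ_le_const2[OF tendsto_rabs[OF Vlim]]) (use C in auto)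
    then show "bounded (range W)"
      by (auto simp: bounded_iff)
  qed
  have "action (\<lambda>x. V (x + a)) v \<le> action W v"
    unfolding action_def
    by (intro diff_right_mono add_left_mono infsum_mono potential_summable v(1) Va Wb mult_right_mono dom)
      simp
  then have le: "action V (\<lambda>x. v (x + - a)) \<le> m"
    using v'(2) action_translate[of V a "\<lambda>x. v (x + - a)"] by simp
  define u where "u x = \<bar>v (x + - a)\<bar>" for x
  have adm: "admissible u" and mass: "mass u = 1"
    unfolding u_def using v' v mass_translate[of v "- a"]
    by (simp_all only: admissible_abs admissible_translate) (simp add: mass_def)
  have "action V u \<le> m"
    using action_abs_le[of "\<lambda>x. v (x + - a)" V, OF square_summable_translate[THEN iffD2, OF v(1)]] le
    unfolding u_def by (rule order_trans)
  with log_sobolev_unit[OF m adm mass] have "action V u = m"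
    by simp
  then show ?thesis
    using that[OF m adm mass] by (simp add: u_def)
qed

section \<open>The Euler-Lagrange equation\<close>

lemma has_sum_change_at:
  fixes g :: "'a \<Rightarrow> real \<Rightarrow> real"
  assumes "((\<lambda>x. g x (u x)) has_sum s) UNIV"
  shows "((\<lambda>x. g x (u x + (if x = z then t else 0))) has_sum s + (g z (u z + t) - g z (u z))) UNIV"
proof -
  let ?h = "\<lambda>x. if x = z then g z (u z + t) - g z (u z) else 0"
  have "(?h has_sum (g z (u z + t) - g z (u z))) UNIV"
    by (rule has_sum_finite_neutralI[of "{z}"]) auto
  with assms have "((\<lambda>x. g x (u x) + ?h x) has_sum s + (g z (u z + t) - g z (u z))) UNIV"
    by (rule has_sum_add)
  then show ?thesis
    by (rule has_sum_cong[THEN iffD1, rotated]) auto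
qed

text \<open>Perturbing a minimiser at the single vertex \<open>z\<close> gives a differentiable function of one
  variable with a minimum at 0. The term \<open>m u\<close> is the Lagrange multiplier of the mass
  constraint.\<close>

lemma minimiser_equation:
  fixes u :: "int ^ 'n \<Rightarrow> real"
  assumes V: "bounded (range V)" and m: "log_sobolev V m"
    and u: "admissible u" and mass: "mass u = 1" and action: "action V u = m"
  shows "- laplacian u z + V z * u z = u z * ln ((u z)\<^sup>2) + m * u z"
proof -
  define s where "s = u z"
  define \<delta> :: "real \<Rightarrow> int ^ 'n \<Rightarrow> real" where "\<delta> t x = (if x = z then t else 0)" for t x
  define D where "D = dirichlet (\<delta> 1)"
  define M where "M t = 1 + ((s + t)\<^sup>2 - s\<^sup>2)" for t
  define \<psi> where "\<psi> t = m + D * t\<^sup>2 - 2 * t * laplacian u z + V z * ((s + t)\<^sup>2 - s\<^sup>2)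
    - (sq_ln (s + t) - sq_ln s) - m * M t + M t * ln (M t)" for t
  note squares = admissibleD(1)[OF u, unfolded square_summable_def]
  have \<psi>_nonneg: "0 \<le> \<psi> t" for t
  proof -
    let ?w = "\<lambda>x. u x + \<delta> t x"
    have \<delta>: "square_summable (\<delta> t)"
      by (rule square_summable_finite_support) (rule finite_subset[of _ "{z}"], auto simp: \<delta>_def)
    have "dirichlet (\<delta> t) = D * t\<^sup>2"
    proof -
      have "\<delta> t = (\<lambda>x. t * \<delta> 1 x)"
        by (auto simp: \<delta>_def)
      then show ?thesis
        using dirichlet_scale[of t "\<delta> 1"] by (simp add: D_def)
    qed
    moreover have "(\<Sum>\<^sub>\<infinity>x. \<delta> t x * laplacian u x) = t * laplacian u z"
    proof -
      have "(\<Sum>\<^sub>\<infinity>x. \<delta> t x * laplacian u x) = (\<Sum>\<^sub>\<infinity>x\<in>{z}. t * laplacian u x)"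
        by (rule infsum_cong_neutral) (auto simp: \<delta>_def)
      then show ?thesis
        by simp
    qed
    ultimately have dirichlet: "dirichlet ?w = dirichlet u + D * t\<^sup>2 - 2 * t * laplacian u z"
      using dirichlet_add[OF admissibleD(1)[OF u] \<delta>] by simp
    have pot: "((\<lambda>x. V x * (?w x)\<^sup>2) has_sum
        (\<Sum>\<^sub>\<infinity>x. V x * (u x)\<^sup>2) + (V z * (s + t)\<^sup>2 - V z * s\<^sup>2)) UNIV"
      using has_sum_change_at[of "\<lambda>x a. V x * a\<^sup>2", OF has_sum_infsum[OF potential_summable[OF V
          admissibleD(1)[OF u]]]] by (simp add: \<delta>_def s_def)
    have ent: "((\<lambda>x. sq_ln (?w x)) has_sum (\<Sum>\<^sub>\<infinity>x. sq_ln (u x)) + (sq_ln (s + t) - sq_ln s)) UNIV"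
      using has_sum_change_at[of "\<lambda>_. sq_ln", OF has_sum_infsum[OF admissibleD(2)[OF u]]]
      by (simp add: \<delta>_def s_def)
    have sq: "((\<lambda>x. (?w x)\<^sup>2) has_sum M t) UNIV"
      using has_sum_change_at[of "\<lambda>_ a. a\<^sup>2", OF has_sum_infsum[OF squares]] mass
      by (simp add: \<delta>_def s_def M_def mass_def)
    have "admissible ?w" and "mass ?w = M t"
      using sq ent by (auto simp: admissible_def square_summable_def mass_def has_sum_iff)
    moreover have "action V ?w = m + D * t\<^sup>2 - 2 * t * laplacian u z
        + V z * ((s + t)\<^sup>2 - s\<^sup>2) - (sq_ln (s + t) - sq_ln s)"
      using action dirichlet infsumI[OF pot] infsumI[OF ent]
      by (simp add: action_def algebra_simps)
    ultimately show ?thesis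
      using m unfolding log_sobolev_def \<psi>_def by fastforce
  qed
  have "((\<lambda>t. sq_ln (s + t)) has_real_derivative (2 * s * ln (s\<^sup>2) + 2 * s) * 1) (at 0)"
    by (rule DERIV_chain2[where f = sq_ln]) (auto intro!: derivative_eq_intros DERIV_sq_ln[of s, simplified])
  then have "(\<psi> has_real_derivative
      - 2 * laplacian u z + 2 * V z * s - 2 * s * ln (s\<^sup>2) - 2 * m * s) (at 0)"
    unfolding \<psi>_def[abs_def] M_def
    by (auto intro!: derivative_eq_intros simp: algebra_simps)
  then have "- 2 * laplacian u z + 2 * V z * s - 2 * s * ln (s\<^sup>2) - 2 * m * s = 0"
  proof (rule DERIV_local_min)
    have "\<psi> 0 = 0"
      by (simp add: \<psi>_def M_def)
    then show "\<forall>t. \<bar>0 - t\<bar> < 1 \<longrightarrow> \<psi> 0 \<le> \<psi> t"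
      using \<psi>_nonneg by simp
  qed simp
  then show ?thesis
    by (simp add: s_def algebra_simps)
qed

text \<open>At a zero of a nonnegative solution the equation reduces to \<open>\<Delta>u = 0\<close>, so the zero spreads to
  all neighbours.\<close>

lemma nonneg_solution_pos:
  fixes u :: "int ^ 'n \<Rightarrow> real"
  assumes eq: "\<And>z. - laplacian u z + V z * u z = u z * ln ((u z)\<^sup>2) + m * u z"
    and nonneg: "\<And>x. 0 \<le> u x" and nz: "u \<noteq> (\<lambda>_. 0)"
  shows "0 < u x"
proof (rule ccontr)
  assume "\<not> 0 < u x"
  then have "x \<in> {x. u x = 0}"
    using nonneg[of x] by simp
  moreover have "y \<in> {x. u x = 0}" if "z \<in> {x. u x = 0}" and "z \<sim> y" for y z
  proof -
    have "(\<Sum>y | z \<sim> y. u y) = 0"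
      using eq[of z] that(1) by (simp add: laplacian_def)
    then show ?thesis
      using that(2) nonneg by (simp add: sum_nonneg_eq_0_iff finite_neighbours)
  qed
  ultimately have "{x. u x = 0} = UNIV"
    by (rule neighbour_closed_eq_UNIV)
  with nz show False
    by auto
qed

section \<open>The function spaces and the energy\<close>

lemma dirichlet_le_mass:
  fixes u :: "int ^ 'n \<Rightarrow> real"
  assumes u: "square_summable u"
  shows "dirichlet u \<le> 2 * real (card (unit_vectors :: (int ^ 'n) set)) * mass u"
proof -
  let ?d = "real (card (unit_vectors :: (int ^ 'n) set))"
  note swap = edge_sum_swap[of "\<lambda>x y. (u x)\<^sup>2", OF u[unfolded square_summable_def]]
  have degree: "(\<Sum>y | x \<sim> y. (u x)\<^sup>2) = ?d * (u x)\<^sup>2" for x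
    by (subst sum_neighbours) simp
  have "dirichlet u \<le> (\<Sum>\<^sub>\<infinity>x. (\<Sum>y | x \<sim> y. (u x)\<^sup>2) + (\<Sum>y | x \<sim> y. (u y)\<^sup>2))"
    unfolding dirichlet_def
  proof (rule infsum_mono[OF grad_sq_summable[OF u] summable_on_add[OF swap(1,2)]])
    fix x
    have "(a - b)\<^sup>2 \<le> 2 * (b\<^sup>2 + a\<^sup>2)" for a b :: real
      using zero_le_power2[of "a + b"] by (simp add: power2_eq_square algebra_simps)
    then have "grad_sq u x \<le> 1 / 2 * (\<Sum>y | x \<sim> y. 2 * ((u x)\<^sup>2 + (u y)\<^sup>2))"
      unfolding grad_sq_def by (intro mult_left_mono sum_mono) auto
    also have "\<dots> = (\<Sum>y | x \<sim> y. (u x)\<^sup>2) + (\<Sum>y | x \<sim> y. (u y)\<^sup>2)"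
      unfolding sum_distrib_left[symmetric] sum.distrib by simp
    finally show "grad_sq u x \<le> (\<Sum>y | x \<sim> y. (u x)\<^sup>2) + (\<Sum>y | x \<sim> y. (u y)\<^sup>2)" .
  qed
  also have "\<dots> = (\<Sum>\<^sub>\<infinity>x. \<Sum>y | x \<sim> y. (u x)\<^sup>2) + (\<Sum>\<^sub>\<infinity>x. \<Sum>y | x \<sim> y. (u y)\<^sup>2)"
    by (rule infsum_add[OF swap(1,2)])
  also have "\<dots> = 2 * ?d * mass u"
    unfolding swap(3) degree infsum_cmult_right' mass_def by simp
  finally show ?thesis .
qed

lemma H1_norm_sq_eq:
  assumes "square_summable u"
  shows "H1_norm_sq u = ereal (dirichlet u + mass u)"
  unfolding H1_norm_sq_def dirichlet_def mass_def
  using infsum_add[OF grad_sq_summable[OF assms] assms[unfolded square_summable_def]]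
    summable_on_add[OF grad_sq_summable[OF assms] assms[unfolded square_summable_def]]
  by (simp add: integral_count_summable)

lemma H1_norm_sq_not_square_summable:
  assumes "\<not> square_summable u"
  shows "H1_norm_sq u = \<infinity>"
  unfolding H1_norm_sq_def
proof (rule integral_count_nonneg_not_summable)
  show "\<not> (\<lambda>x. grad_sq u x + (u x)\<^sup>2) summable_on UNIV"
  proof
    assume "(\<lambda>x. grad_sq u x + (u x)\<^sup>2) summable_on UNIV"
    then have "square_summable u"
      unfolding square_summable_def
      by (rule summable_on_comparison_test) (simp_all add: grad_sq_nonneg)
    with assms show False ..
  qed
qed (simp add: grad_sq_nonneg)

text \<open>The Dirichlet energy is bounded by the mass, so the norm is equivalent to that of \<open>l\<^sup>2\<close>, where
  finitely supported functions are dense.\<close>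

lemma H1_iff: "u \<in> H1 \<longleftrightarrow> square_summable u"
proof
  assume "u \<in> H1"
  then obtain \<phi> where fin: "\<And>k :: nat. finite {x. \<phi> k x \<noteq> 0}"
    and lim: "(\<lambda>k. H1_norm_sq (\<lambda>x. u x - \<phi> k x)) \<longlonglongrightarrow> 0"
    by (auto simp: H1_def)
  have "\<forall>\<^sub>F k in sequentially. H1_norm_sq (\<lambda>x. u x - \<phi> k x) < 1"
    using lim by (rule order_tendstoD(2)) simp
  then obtain k where "H1_norm_sq (\<lambda>x. u x - \<phi> k x) < 1"
    by (auto simp: eventually_sequentially)
  then have "square_summable (\<lambda>x. u x - \<phi> k x)"
    using H1_norm_sq_not_square_summable by fastforce
  from square_summable_add[OF this square_summable_finite_support[OF fin[of k]]]
  show "square_summable u"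
    by simp
next
  assume u: "square_summable u"
  let ?d = "real (card (unit_vectors :: (int ^ 'a) set))"
  have "\<exists>F. finite F \<and> mass (restrict_to (- F) u) < 1 / real (Suc k)" for k
  proof -
    have "\<forall>\<^sub>F F in finite_subsets_at_top UNIV. mass u - 1 / real (Suc k) < (\<Sum>x\<in>F. (u x)\<^sup>2)"
      using infsum_tendsto[OF u[unfolded square_summable_def]]
      by (rule order_tendstoD(1)) (simp add: mass_def)
    then obtain F where "finite F" and "mass u - 1 / real (Suc k) < (\<Sum>x\<in>F. (u x)\<^sup>2)"
      by (auto simp: eventually_finite_subsets_at_top)
    then show ?thesis
      using mass_restrict_cofinite[OF u, of F] by (intro exI[of _ F]) simp
  qed
  then obtain F where F: "\<And>k. finite (F k)"
    and small: "\<And>k. mass (restrict_to (- F k) u) < 1 / real (Suc k)"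
    by metis
  let ?r = "\<lambda>k. restrict_to (- F k) u"
  have r: "(\<lambda>x. u x - restrict_to (F k) u x) = ?r k" for k
    by (auto simp: restrict_to_def)
  have "(\<lambda>k. dirichlet (?r k) + mass (?r k)) \<longlonglongrightarrow> 0"
  proof (rule tendsto_sandwich[where f = "\<lambda>_. 0" and h = "\<lambda>k. (2 * ?d + 1) * (1 / real (Suc k))"])
    show "\<forall>\<^sub>F k in sequentially. dirichlet (?r k) + mass (?r k) \<le> (2 * ?d + 1) * (1 / real (Suc k))"
    proof (intro always_eventually allI)
      fix k
      have "dirichlet (?r k) + mass (?r k) \<le> (2 * ?d + 1) * mass (?r k)"
        using dirichlet_le_mass[OF square_summable_restrict[OF u], of "- F k"]
        by (simp add: algebra_simps)
      also have "\<dots> \<le> (2 * ?d + 1) * (1 / real (Suc k))"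
        using small[of k] by (intro mult_left_mono) auto
      finally show "dirichlet (?r k) + mass (?r k) \<le> (2 * ?d + 1) * (1 / real (Suc k))" .
    qed
    show "(\<lambda>k. (2 * ?d + 1) * (1 / real (Suc k))) \<longlonglongrightarrow> 0"
      using tendsto_mult_right_zero[OF LIMSEQ_inverse_real_of_nat] by (simp only: inverse_eq_divide)
  qed (auto simp: dirichlet_nonneg mass_nonneg)
  then have "(\<lambda>k. ereal (dirichlet (?r k) + mass (?r k))) \<longlonglongrightarrow> ereal 0"
    by (rule tendsto_ereal)
  then have "(\<lambda>k. H1_norm_sq (\<lambda>x. u x - restrict_to (F k) u x)) \<longlonglongrightarrow> 0"
    unfolding r H1_norm_sq_eq[OF square_summable_restrict[OF u]] zero_ereal_def .
  moreover have "finite {x. restrict_to (F k) u x \<noteq> 0}" for k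
    by (rule finite_subset[OF _ F[of k]]) (auto simp: restrict_to_def)
  ultimately show "u \<in> H1"
    unfolding H1_def mem_Collect_eq by (intro exI[of _ "\<lambda>k. restrict_to (F k) u"] conjI allI)
qed

lemma energy_space_iff:
  fixes u :: "int ^ 'n \<Rightarrow> real"
  assumes V: "bounded (range V)"
  shows "u \<in> energy_space V \<longleftrightarrow> square_summable u"
proof -
  have "integral_count (\<lambda>x. (V x + 1) * (u x)\<^sup>2) < \<infinity>" if "square_summable u"
    using integral_count_summable[OF summable_on_add[OF potential_summable[OF V that]
        that[unfolded square_summable_def]]]
    by (simp add: distrib_right)
  then show ?thesis
    by (auto simp: energy_space_def H1_iff)
qed

lemma integral_count_dirichlet_potential:
  fixes u :: "int ^ 'n \<Rightarrow> real"
  assumes V: "bounded (range V)" and u: "square_summable u"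
  shows "integral_count (\<lambda>x. grad_sq u x + V x * (u x)\<^sup>2) =
    ereal (dirichlet u + (\<Sum>\<^sub>\<infinity>x. V x * (u x)\<^sup>2))"
  unfolding dirichlet_def infsum_add[OF grad_sq_summable[OF u] potential_summable[OF V u], symmetric]
  by (rule integral_count_summable)
    (rule summable_on_add[OF grad_sq_summable[OF u] potential_summable[OF V u]])

text \<open>A square-summable function is bounded, so the positive part of \<open>u\<^sup>2 ln u\<^sup>2\<close> is dominated by a
  multiple of \<open>u\<^sup>2\<close>, and only the negative part can have an infinite integral.\<close>

lemma integral_count_sq_ln:
  assumes u: "square_summable u"
  shows "integral_count (\<lambda>x. (u x)\<^sup>2 * ln ((u x)\<^sup>2)) =
    (if admissible u then ereal (\<Sum>\<^sub>\<infinity>x. sq_ln (u x)) else - \<infinity>)"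
proof -
  have "(\<lambda>x. max 0 (sq_ln (u x))) summable_on UNIV"
  proof (rule summable_on_dominated)
    show "(\<lambda>x. \<bar>ln (mass u)\<bar> * (u x)\<^sup>2) summable_on UNIV"
      using u unfolding square_summable_def by (rule summable_on_cmult_right)
    show "\<bar>max 0 (sq_ln (u x))\<bar> \<le> \<bar>ln (mass u)\<bar> * (u x)\<^sup>2" for x
    proof (cases "u x = 0")
      case False
      then have "ln ((u x)\<^sup>2) \<le> ln (mass u)"
        using square_le_mass[OF u, of x] zero_less_power2[of "u x"] by (intro ln_mono) auto
      then have "ln ((u x)\<^sup>2) * (u x)\<^sup>2 \<le> \<bar>ln (mass u)\<bar> * (u x)\<^sup>2"
        by (intro mult_right_mono) auto
      then show ?thesis
        by (simp add: sq_ln_def mult.commute)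
    qed simp
  qed
  then show ?thesis
    using integral_count_summable[of "\<lambda>x. sq_ln (u x)"]
      integral_count_eq_minus_infinity[of "\<lambda>x. sq_ln (u x)"] u
    by (auto simp: admissible_def sq_ln_def)
qed

lemma energy_eq:
  fixes u :: "int ^ 'n \<Rightarrow> real"
  assumes V: "bounded (range V)" and u: "square_summable u"
  shows "energy V u = (if admissible u then ereal ((action V u + mass u) / 2) else \<infinity>)"
proof -
  have V1: "bounded (range (\<lambda>x. V x + 1))"
  proof -
    obtain C where C: "\<And>x. \<bar>V x\<bar> \<le> C"
      using V by (auto simp: bounded_iff)
    have "\<bar>V x + 1\<bar> \<le> C + 1" for x
      using C[of x] by arith
    then show ?thesis
      by (auto simp: bounded_iff)
  qed
  have "(\<Sum>\<^sub>\<infinity>x. (V x + 1) * (u x)\<^sup>2) = (\<Sum>\<^sub>\<infinity>x. V x * (u x)\<^sup>2) + mass u"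
    using infsum_add[OF potential_summable[OF V u] u[unfolded square_summable_def]]
    by (simp add: distrib_right mass_def)
  then show ?thesis
    unfolding energy_def integral_count_dirichlet_potential[OF V1 u] integral_count_sq_ln[OF u]
    by (simp add: action_def field_simps)
qed

lemma energy_domain_iff:
  assumes "bounded (range V)"
  shows "u \<in> energy_domain V \<longleftrightarrow> admissible u"
  using energy_eq[OF assms, of u]
  by (auto simp: energy_domain_def energy_space_iff[OF assms] admissible_def split: if_splits)

lemma nehari_iff:
  assumes V: "bounded (range V)"
  shows "u \<in> nehari V \<longleftrightarrow> admissible u \<and> u \<noteq> (\<lambda>_. 0) \<and> action V u = 0"
proof -
  have "integral_count (\<lambda>x. grad_sq u x + V x * (u x)\<^sup>2)
      = integral_count (\<lambda>x. (u x)\<^sup>2 * ln ((u x)\<^sup>2)) \<longleftrightarrow> action V u = 0" if "admissible u"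
    using that
    by (simp add: integral_count_dirichlet_potential[OF V] integral_count_sq_ln admissibleD(1)
        action_def)
  then show ?thesis
    by (auto simp: nehari_def energy_domain_iff[OF V])
qed

section \<open>Ground states\<close>

theorem theorem1p4:
  fixes V :: "int ^ 'n \<Rightarrow> real" and V_inf :: real
  assumes "-1 < (INF x. ereal (V x))"
    and "(INF x. ereal (V x)) \<le> (SUP x. ereal (V x))"
    and "(SUP x. ereal (V x)) = ereal V_inf"
    and "(V \<longlongrightarrow> V_inf) lattice_at_infinity"
  shows "\<exists>u. is_ground_state V u \<and> ((\<forall>x. u x > 0) \<or> (\<forall>x. u x < 0))"
proof -
  have upper: "V x \<le> V_inf" for x
    using SUP_upper[of x UNIV "\<lambda>x. ereal (V x)"] assms(3) by simp
  have "- 1 < V x" for x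
  proof -
    have "- 1 < ereal (V x)"
      using less_INF_D[OF assms(1), of x] by simp
    then show ?thesis
      by (simp add: one_ereal_def)
  qed
  with upper have "\<bar>V x\<bar> \<le> max 1 \<bar>V_inf\<bar>" for x
    by (smt (verit))
  then have V: "bounded (range V)"
    by (auto simp: bounded_iff)
  obtain m u where m: "log_sobolev V m" and u: "admissible u" "mass u = 1" "action V u = m"
    and nonneg: "\<And>x. 0 \<le> u x"
    using minimiser_exists[OF V assms(4) upper] by blast
  note eq = minimiser_equation[OF V m u]
  have "u \<noteq> (\<lambda>_. 0)"
    using u(2) by (auto simp: mass_def)
  then have pos: "0 < u x" for x
    using nonneg_solution_pos[OF eq nonneg] by blast
  \<comment> \<open>This factor turns the multiplier \<open>m\<close> into the logarithm of \<open>c\<^sup>2\<close> and puts the minimiser on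
    the Nehari manifold.\<close>
  define c where "c = exp (m / 2)"
  have c: "c\<^sup>2 = exp m" "0 < c"
    by (simp_all add: c_def power2_eq_square flip: exp_add)
  define w where "w x = c * u x" for x
  have w_pos: "0 < w x" for x
    using pos c(2) by (simp add: w_def)
  have w: "admissible w" "mass w = exp m" "action V w = 0"
    unfolding w_def using admissible_scale[OF u(1)] action_scale[OF u(1), of V c] u c
    by (simp_all add: mass_scale)
  have w_nz: "w \<noteq> (\<lambda>_. 0)"
    using w_pos[of 0] by auto
  have "- laplacian w x + V x * w x = w x * ln ((w x)\<^sup>2)" for x
  proof -
    have "laplacian w x = c * laplacian u x"
      by (simp add: laplacian_def w_def sum_distrib_left right_diff_distrib)
    then have "- laplacian w x + V x * w x = c * (- laplacian u x + V x * u x)"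
      by (simp add: w_def algebra_simps)
    also have "\<dots> = w x * (ln ((u x)\<^sup>2) + m)"
      unfolding eq by (simp add: w_def algebra_simps)
    also have "ln ((u x)\<^sup>2) + m = ln ((w x)\<^sup>2)"
      using pos[of x] c by (simp add: w_def power_mult_distrib ln_mult)
    finally show ?thesis .
  qed
  then have "is_solution V w"
    using w(1) by (simp add: is_solution_def energy_domain_iff[OF V])
  moreover have "energy V w = (INF v\<in>nehari V. energy V v)"
  proof (rule antisym)
    show "energy V w \<le> (INF v\<in>nehari V. energy V v)"
    proof (rule INF_greatest)
      fix v
      assume "v \<in> nehari V"
      then have v: "admissible v" "v \<noteq> (\<lambda>_. 0)" "action V v = 0"
        by (simp_all add: nehari_iff[OF V])
      have v_pos: "0 < mass v"
        using mass_pos[OF admissibleD(1)[OF v(1)] v(2)] .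
      have "m * mass v - mass v * ln (mass v) \<le> 0"
        using m v unfolding log_sobolev_def by fastforce
      then have "mass v * m \<le> mass v * ln (mass v)"
        by (simp add: mult.commute)
      then have "m \<le> ln (mass v)"
        using v_pos by simp
      then have "exp m \<le> mass v"
        using v_pos by (simp add: ln_ge_iff)
      then show "energy V w \<le> energy V v"
        using v w by (simp add: energy_eq[OF V admissibleD(1)])
    qed
    show "(INF v\<in>nehari V. energy V v) \<le> energy V w"
      using w w_nz by (intro INF_lower) (simp add: nehari_iff[OF V])
  qed
  ultimately have "is_ground_state V w"
    using w_nz by (simp add: is_ground_state_def)
  then show ?thesis
    using w_pos by blast
qed

end
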